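(* Let $\alpha\vDash n$ and $\beta\vDash m$ be compositions with $\beta\subseteq\alpha$. For the $\mathcal{R}\mathfrak{S}^*$-action, $\operatorname{span}\{T:T\in\mathrm{SET}(\alpha/\beta)\}$ is an $H_{n-m}(0)$-submodule of $\mathcal{V}_{\alpha/\beta}$ with quasisymmetric characteristic $\mathcal{R}\mathcal{E}_{\alpha/\beta}$. For the $\mathcal{A}^*$-action, $\operatorname{span}\{T:T\in\mathrm{SET}(\alpha/\beta)\}$ is an $H_{n-m}(0)$-submodule of $\mathcal{A}_{\alpha/\beta}$ with quasisymmetric characteristic $\mathcal{A}^*_{\mathrm{SET}(\alpha/\beta)}$.
   Context: Compositions and tableaux. A composition $\alpha=(\alpha_1,\dots,\alpha_k)\vDash n$ is a finite sequence of positive integers with sum $n=|\alpha|$; $\ell(\alpha)=k$; $\emptyset$ is the empty composition of $0$. The diagram of $\alpha$ is the left-justified array of cells with $\alpha_i$ cells in row $i$, rows numbered from bottom to top. $\beta\subseteq\alpha$ means $\ell(\beta)\le\ell(\alpha)$ and $\beta_j\le\alpha_j$ for all $1\le j\le \ell(\beta)$; the skew diagram $\alpha/\beta$ is the set of cells of the diagram of $\alpha$ not in that of $\beta$, where $\beta$ is placed in the bottom-left corner of $\alpha$. $\mathrm{SIT}(\alpha/\beta)$ is the set of bijective fillings of the cells of $\alpha/\beta$ with $1,\dots,|\alpha|-|\beta|$ such that the entries in the cells of the leftmost column of $\alpha$ that are not in $\beta$ increase from bottom to top, and all rows increase from left to right. $\mathrm{SET}(\alpha/\beta)$ is the subset of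 those $T\in\mathrm{SIT}(\alpha/\beta)$ in which the entries of every column increase from bottom to top (cells of $\beta$, being empty, are ignored). Descent sets. For $T\in\mathrm{SIT}(\alpha/\beta)$ and $1\le i\le|\alpha|-|\beta|-1$: $i\in\mathrm{Des}_{\mathcal{R}\mathfrak{S}^*}(T)$ iff $i+1$ is in a row weakly below $i$; $i\in\mathrm{Des}_{\mathcal{A}^*}(T)$ iff $i+1$ is in a row strictly below $i$. 0-Hecke algebra and actions. $H_N(0)$ is the $\mathbb{C}$-algebra with generators $\pi_1,\dots,\pi_{N-1}$ and relations $\pi_i^2=\pi_i$, $\pi_i\pi_{i+1}\pi_i=\pi_{i+1}\pi_i\pi_{i+1}$, $\pi_i\pi_j=\pi_j\pi_i$ for $|i-j|\ge2$. Let $s_i$ switch the entries $i,i+1$. For $a\in\{\mathcal{R}\mathfrak{S}^*,\mathcal{A}^*\}$ the $a$-action of $H_{n-m}(0)$ on the complex vector space with basis $\mathrm{SIT}(\alpha/\beta)$ is $\pi_i^a(T)=T$ if $i\notin\mathrm{Des}_a(T)$; $\pi_i^a(T)=s_i(T)$ if $i\in\mathrm{Des}_a(T)$ and $s_i(T)\in\mathrm{SIT}(\alpha/\beta)$; $\pi_i^a(T)=0$ otherwise. The resulting modules are $\mathcal{V}_{\alpha/\beta}$ (for $a=\mathcal{R}\mathfrak{S}^*$) and $\mathcal{A}_{\alpha/\beta}$ (for $a=\mathcal{A}^*$). Quasisymmetric functions. For $S=\{s_1<\dots<s_j\}\subseteq\{1,\dots,N-1\}$, $\mathrm{comp}(S)=(s_1,s_2-s_1,\dots,N-s_j)\vDash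 N$, with inverse $\mathrm{set}(\gamma)=\{\gamma_1,\gamma_1+\gamma_2,\dots,\gamma_1+\dots+\gamma_{\ell(\gamma)-1}\}$. For $\gamma\vDash N$, $F_\gamma=\sum x_{i_1}\cdots x_{i_N}$ over $i_1\le\cdots\le i_N$ with $i_j<i_{j+1}$ if $j\in\mathrm{set}(\gamma)$. The simple $H_N(0)$-modules are the one-dimensional $L_\gamma=\mathrm{span}\{v_\gamma\}$, $\gamma\vDash N$, with $\pi_iv_\gamma=0$ if $i\in\mathrm{set}(\gamma)$ and $\pi_iv_\gamma=v_\gamma$ otherwise. The quasisymmetric characteristic of a finite-dimensional $H_N(0)$-module is the sum of $F_\gamma$ over its composition factors $L_\gamma$ (with multiplicity). Define $\mathcal{R}\mathcal{E}_{\alpha/\beta}=\sum_{T\in\mathrm{SET}(\alpha/\beta)}F_{\mathrm{comp}(\mathrm{Des}_{\mathcal{R}\mathfrak{S}^*}(T))}$ and $\mathcal{A}^*_{\mathrm{SET}(\alpha/\beta)}=\sum_{T\in\mathrm{SET}(\alpha/\beta)}F_{\mathrm{comp}(\mathrm{Des}_{\mathcal{A}^*}(T))}$. *)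

theory Defs
  imports Complex_Main "HOL-Algebra.QuotRing" "HOL-Algebra.Module"
    "HOL-Library.Poly_Mapping" "HOL-Library.Multiset"
    "HOL-Combinatorics.Transposition"
begin

section \<open>Compositions and tableaux\<close>

definition composition :: "nat list \<Rightarrow> nat \<Rightarrow> bool" where
  "composition \<alpha> n \<longleftrightarrow> (\<forall>a\<in>set \<alpha>. 0 < a) \<and> sum_list \<alpha> = n"

definition comp_contained :: "nat list \<Rightarrow> nat list \<Rightarrow> bool" where
  "comp_contained \<beta> \<alpha> \<longleftrightarrow> length \<beta> \<le> length \<alpha> \<and> (\<forall>j<length \<beta>. \<beta> ! j \<le> \<alpha> ! j)"

text \<open>A cell is a pair (row, column); both are counted from \<open>0\<close>, rows from bottom to top.\<close>

definition diagram :: "nat list \<Rightarrow> (nat \<times> nat) set" where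
  "diagram \<alpha> = {(r, c). r < length \<alpha> \<and> c < \<alpha> ! r}"

definition skew :: "nat list \<Rightarrow> nat list \<Rightarrow> (nat \<times> nat) set" where
  "skew \<alpha> \<beta> = diagram \<alpha> - diagram \<beta>"

text \<open>Fillings are total functions with the value \<open>0\<close>, which is never an entry, off the diagram.\<close>

type_synonym filling = "nat \<times> nat \<Rightarrow> nat"

definition SIT :: "nat list \<Rightarrow> nat list \<Rightarrow> filling set" where
  "SIT \<alpha> \<beta> = {T.
     (\<forall>x. x \<notin> skew \<alpha> \<beta> \<longrightarrow> T x = 0) \<and>
     bij_betw T (skew \<alpha> \<beta>) {1..sum_list \<alpha> - sum_list \<beta>} \<and>
     (\<forall>r r'. (r, 0) \<in> skew \<alpha> \<beta> \<and> (r', 0) \<in> skew \<alpha> \<beta> \<and> r < r' \<longrightarrow> T (r, 0) < T (r', 0)) \<and>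
     (\<forall>r c c'. (r, c) \<in> skew \<alpha> \<beta> \<and> (r, c') \<in> skew \<alpha> \<beta> \<and> c < c' \<longrightarrow> T (r, c) < T (r, c'))}"

definition SET :: "nat list \<Rightarrow> nat list \<Rightarrow> filling set" where
  "SET \<alpha> \<beta> = {T \<in> SIT \<alpha> \<beta>.
     \<forall>r r' c. (r, c) \<in> skew \<alpha> \<beta> \<and> (r', c) \<in> skew \<alpha> \<beta> \<and> r < r' \<longrightarrow> T (r, c) < T (r', c)}"

definition row_of :: "filling \<Rightarrow> nat \<Rightarrow> nat" where
  "row_of T i = (THE r. \<exists>c. T (r, c) = i)"

definition Des_RS :: "nat list \<Rightarrow> nat list \<Rightarrow> filling \<Rightarrow> nat set" where
  "Des_RS \<alpha> \<beta> T = {i \<in> {1..<sum_list \<alpha> - sum_list \<beta>}. row_of T (i + 1) \<le> row_of T i}"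

definition Des_A :: "nat list \<Rightarrow> nat list \<Rightarrow> filling \<Rightarrow> nat set" where
  "Des_A \<alpha> \<beta> T = {i \<in> {1..<sum_list \<alpha> - sum_list \<beta>}. row_of T (i + 1) < row_of T i}"


section \<open>Quasisymmetric functions\<close>

definition comp_of_set :: "nat \<Rightarrow> nat set \<Rightarrow> nat list" where
  "comp_of_set N S =
     (if N = 0 then []
      else let xs = sorted_list_of_set S in map2 (-) (xs @ [N]) (0 # xs))"

definition set_of_comp :: "nat list \<Rightarrow> nat set" where
  "set_of_comp \<gamma> = {sum_list (take k \<gamma>) | k. 1 \<le> k \<and> k < length \<gamma>}"

text \<open>
  A formal power series in \<open>x\<^sub>1, x\<^sub>2, \<dots>\<close> is given by its coefficients; the monomial
  \<open>x\<^bsub>i_1\<^esub> \<cdots> x\<^bsub>i_N\<^esub>\<close> is the multiset of the indices \<open>i_1, \<dots>, i_N\<close>.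
  The coefficient of a monomial in \<open>F_\<gamma>\<close> counts the admissible index sequences producing it.
  List positions start at \<open>0\<close>, so \<open>i_j < i_{j+1}\<close> reads \<open>is ! (j - 1) < is ! j\<close>.
\<close>

type_synonym qsym = "nat multiset \<Rightarrow> int"

definition fundamental_qsym :: "nat list \<Rightarrow> qsym" where
  "fundamental_qsym \<gamma> = (\<lambda>mon. int (card {is.
     length is = sum_list \<gamma> \<and> (\<forall>i\<in>set is. 1 \<le> i) \<and>
     (\<forall>j\<in>{1..<sum_list \<gamma>}. is ! (j - 1) \<le> is ! j) \<and>
     (\<forall>j\<in>{1..<sum_list \<gamma>} \<inter> set_of_comp \<gamma>. is ! (j - 1) < is ! j) \<and>
     mset is = mon}))"

definition RE :: "nat list \<Rightarrow> nat list \<Rightarrow> qsym" where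
  "RE \<alpha> \<beta> = (\<lambda>mon. \<Sum>T\<in>SET \<alpha> \<beta>.
     fundamental_qsym (comp_of_set (sum_list \<alpha> - sum_list \<beta>) (Des_RS \<alpha> \<beta> T)) mon)"

definition A_SET :: "nat list \<Rightarrow> nat list \<Rightarrow> qsym" where
  "A_SET \<alpha> \<beta> = (\<lambda>mon. \<Sum>T\<in>SET \<alpha> \<beta>.
     fundamental_qsym (comp_of_set (sum_list \<alpha> - sum_list \<beta>) (Des_A \<alpha> \<beta> T)) mon)"


section \<open>Complex vector spaces with a given basis\<close>

definition cscale :: "complex \<Rightarrow> ('b \<Rightarrow>\<^sub>0 complex) \<Rightarrow> 'b \<Rightarrow>\<^sub>0 complex" where
  "cscale c v = Poly_Mapping.map ((*) c) v"

lemma lookup_cscale [simp]: "Poly_Mapping.lookup (cscale c v) b = c * Poly_Mapping.lookup v b"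
  unfolding cscale_def by transfer (simp add: when_def)

global_interpretation cfree: vector_space cscale
  by unfold_locales
    (auto intro!: poly_mapping_eqI simp: lookup_add algebra_simps)

definition basis_vec :: "'b \<Rightarrow> 'b \<Rightarrow>\<^sub>0 complex" where
  "basis_vec b = Poly_Mapping.single b 1"

definition basis_span :: "'b set \<Rightarrow> ('b \<Rightarrow>\<^sub>0 complex) set" where
  "basis_span B = cfree.span (basis_vec ` B)"

definition linear_ext :: "('b \<Rightarrow> 'b \<Rightarrow>\<^sub>0 complex) \<Rightarrow> ('b \<Rightarrow>\<^sub>0 complex) \<Rightarrow> 'b \<Rightarrow>\<^sub>0 complex" where
  "linear_ext f v = (\<Sum>b\<in>Poly_Mapping.keys v. cscale (Poly_Mapping.lookup v b) (f b))"


section \<open>The 0-Hecke algebra\<close>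

text \<open>
  Words form a monoid under concatenation, so \<open>nat list \<Rightarrow>\<^sub>0 complex\<close>, with the convolution
  product of the library, is the free unital algebra on generators indexed by \<open>nat\<close>.
\<close>

instantiation list :: (type) monoid_add
begin

definition zero_list :: "'a list" where "zero_list = []"

definition plus_list :: "'a list \<Rightarrow> 'a list \<Rightarrow> 'a list" where "plus_list xs ys = xs @ ys"

instance
  by standard (simp_all add: zero_list_def plus_list_def)

end

type_synonym free_alg = "nat list \<Rightarrow>\<^sub>0 complex"

definition free_algebra :: "nat \<Rightarrow> free_alg ring" where
  "free_algebra N =
     \<lparr>carrier = {a. Poly_Mapping.keys a \<subseteq> lists {1..<N}},
      monoid.mult = (*), one = 1, zero = 0, add = (+)\<rparr>"

definition gen :: "nat \<Rightarrow> free_alg" where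
  "gen i = Poly_Mapping.single [i] 1"

definition hecke_relators :: "nat \<Rightarrow> free_alg set" where
  "hecke_relators N =
     {gen i * gen i - gen i | i. i \<in> {1..<N}} \<union>
     {gen i * gen (i + 1) * gen i - gen (i + 1) * gen i * gen (i + 1) | i.
        i \<in> {1..<N} \<and> i + 1 \<in> {1..<N}} \<union>
     {gen i * gen j - gen j * gen i | i j.
        i \<in> {1..<N} \<and> j \<in> {1..<N} \<and> (i + 2 \<le> j \<or> j + 2 \<le> i)}"

text \<open>
  The scalars of the \<open>\<complex>\<close>-algebra \<open>H\<^sub>N(0)\<close> are the classes of the constants
  \<open>Poly_Mapping.single [] c\<close>, so its modules and their homomorphisms are automatically
  \<open>\<complex>\<close>-linear.
\<close>

definition hecke0 :: "nat \<Rightarrow> free_alg set ring" where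
  "hecke0 N = free_algebra N Quot (Idl\<^bsub>free_algebra N\<^esub> (hecke_relators N))"


section \<open>Left modules\<close>

text \<open>The axioms of \<^locale>\<open>module\<close> over a ring that need not be commutative.\<close>

locale left_module = R?: ring R + M?: abelian_group M
  for R :: "('a, 'c) ring_scheme" (structure) and M :: "('a, 'b, 'd) module_scheme" (structure) +
  assumes smult_closed:
      "\<lbrakk>a \<in> carrier R; x \<in> carrier M\<rbrakk> \<Longrightarrow> a \<odot>\<^bsub>M\<^esub> x \<in> carrier M"
    and smult_l_distr:
      "\<lbrakk>a \<in> carrier R; b \<in> carrier R; x \<in> carrier M\<rbrakk> \<Longrightarrow>
       (a \<oplus>\<^bsub>R\<^esub> b) \<odot>\<^bsub>M\<^esub> x = a \<odot>\<^bsub>M\<^esub> x \<oplus>\<^bsub>M\<^esub> b \<odot>\<^bsub>M\<^esub> x"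
    and smult_r_distr:
      "\<lbrakk>a \<in> carrier R; x \<in> carrier M; y \<in> carrier M\<rbrakk> \<Longrightarrow>
       a \<odot>\<^bsub>M\<^esub> (x \<oplus>\<^bsub>M\<^esub> y) = a \<odot>\<^bsub>M\<^esub> x \<oplus>\<^bsub>M\<^esub> a \<odot>\<^bsub>M\<^esub> y"
    and smult_assoc1:
      "\<lbrakk>a \<in> carrier R; b \<in> carrier R; x \<in> carrier M\<rbrakk> \<Longrightarrow>
       (a \<otimes>\<^bsub>R\<^esub> b) \<odot>\<^bsub>M\<^esub> x = a \<odot>\<^bsub>M\<^esub> (b \<odot>\<^bsub>M\<^esub> x)"
    and smult_one:
      "x \<in> carrier M \<Longrightarrow> \<one>\<^bsub>R\<^esub> \<odot>\<^bsub>M\<^esub> x = x"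

text \<open>
  On the cosets of a submodule \<open>W\<close> the union below is the single coset of \<open>a \<odot> x\<close>,
  for any \<open>x\<close> in \<open>X\<close>. The multiplicative fields of the record play no role.
\<close>

definition quotient_module ::
  "('a, 'b, 'd) module_scheme \<Rightarrow> 'b set \<Rightarrow> ('a, 'b set) module" where
  "quotient_module M W =
     \<lparr>carrier = a_rcosets\<^bsub>M\<^esub> W, monoid.mult = undefined, one = undefined, zero = W,
      add = set_add M, smult = (\<lambda>a X. \<Union>x\<in>X. W +>\<^bsub>M\<^esub> (a \<odot>\<^bsub>M\<^esub> x))\<rparr>"

definition module_isomorphic ::
  "('a, 'r) ring_scheme \<Rightarrow> ('a, 'b, 'd) module_scheme \<Rightarrow> ('a, 'c, 'e) module_scheme \<Rightarrow> bool" where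
  "module_isomorphic R M M' \<longleftrightarrow>
     (\<exists>f. bij_betw f (carrier M) (carrier M') \<and>
          (\<forall>x\<in>carrier M. \<forall>y\<in>carrier M. f (x \<oplus>\<^bsub>M\<^esub> y) = f x \<oplus>\<^bsub>M'\<^esub> f y) \<and>
          (\<forall>a\<in>carrier R. \<forall>x\<in>carrier M. f (a \<odot>\<^bsub>M\<^esub> x) = a \<odot>\<^bsub>M'\<^esub> f x))"


section \<open>Modules over the 0-Hecke algebra\<close>

text \<open>
  Let \<open>p i b\<close> be the prescribed value of the \<open>i\<close>-th generator on the basis vector \<open>b\<close>.
  A word acts by applying its letters from right to left, and an element \<open>X\<close> of \<open>hecke0 N\<close>,
  being a class of elements of the free algebra, acts as each of its representatives. That
  the representatives agree on the given space is not built into the definition: it holds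
  when the prescribed operators satisfy the defining relations there.
\<close>

definition free_act ::
  "(nat \<Rightarrow> 'b \<Rightarrow> 'b \<Rightarrow>\<^sub>0 complex) \<Rightarrow> free_alg \<Rightarrow> ('b \<Rightarrow>\<^sub>0 complex) \<Rightarrow> 'b \<Rightarrow>\<^sub>0 complex" where
  "free_act p a v = (\<Sum>w\<in>Poly_Mapping.keys a.
     cscale (Poly_Mapping.lookup a w) (foldr (\<lambda>i. linear_ext (p i)) w v))"

definition hecke_act ::
  "(nat \<Rightarrow> 'b \<Rightarrow> 'b \<Rightarrow>\<^sub>0 complex) \<Rightarrow> free_alg set \<Rightarrow> ('b \<Rightarrow>\<^sub>0 complex) \<Rightarrow> 'b \<Rightarrow>\<^sub>0 complex" where
  "hecke_act p X v = (THE u. \<forall>a\<in>X. free_act p a v = u)"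

definition hecke_module ::
  "'b set \<Rightarrow> (nat \<Rightarrow> 'b \<Rightarrow> 'b \<Rightarrow>\<^sub>0 complex) \<Rightarrow> (free_alg set, 'b \<Rightarrow>\<^sub>0 complex) module" where
  "hecke_module B p =
     \<lparr>carrier = basis_span B, monoid.mult = undefined, one = undefined, zero = 0, add = (+),
      smult = hecke_act p\<rparr>"

definition tableau_action ::
  "(filling \<Rightarrow> nat set) \<Rightarrow> nat list \<Rightarrow> nat list \<Rightarrow> nat \<Rightarrow> filling \<Rightarrow> filling \<Rightarrow>\<^sub>0 complex" where
  "tableau_action Des \<alpha> \<beta> i T =
     (if i \<notin> Des T then basis_vec T
      else if transpose i (i + 1) \<circ> T \<in> SIT \<alpha> \<beta> then basis_vec (transpose i (i + 1) \<circ> T)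
      else 0)"

definition V_module :: "nat list \<Rightarrow> nat list \<Rightarrow> (free_alg set, filling \<Rightarrow>\<^sub>0 complex) module" where
  "V_module \<alpha> \<beta> = hecke_module (SIT \<alpha> \<beta>) (tableau_action (Des_RS \<alpha> \<beta>) \<alpha> \<beta>)"

definition A_module :: "nat list \<Rightarrow> nat list \<Rightarrow> (free_alg set, filling \<Rightarrow>\<^sub>0 complex) module" where
  "A_module \<alpha> \<beta> = hecke_module (SIT \<alpha> \<beta>) (tableau_action (Des_A \<alpha> \<beta>) \<alpha> \<beta>)"

definition simple_module :: "nat list \<Rightarrow> (free_alg set, nat list \<Rightarrow>\<^sub>0 complex) module" where
  "simple_module \<gamma> = hecke_module {\<gamma>} (\<lambda>i v. if i \<in> set_of_comp \<gamma> then 0 else basis_vec v)"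

text \<open>
  \<open>Ws\<close> is a chain of submodules from \<open>0\<close> to \<open>M\<close> whose successive quotients are isomorphic to
  the simple modules \<open>L_\<gamma>\<close> for \<open>\<gamma>\<close> in the list \<open>\<Gamma>\<close>, in this order.
\<close>

definition composition_series ::
  "nat \<Rightarrow> (free_alg set, 'b) module \<Rightarrow> 'b set list \<Rightarrow> nat list list \<Rightarrow> bool" where
  "composition_series N M Ws \<Gamma> \<longleftrightarrow>
     length Ws = length \<Gamma> + 1 \<and> hd Ws = {\<zero>\<^bsub>M\<^esub>} \<and> last Ws = carrier M \<and>
     (\<forall>W\<in>set Ws. submodule W (hecke0 N) M) \<and>
     (\<forall>j<length \<Gamma>. Ws ! j \<subseteq> Ws ! (j + 1) \<and> composition (\<Gamma> ! j) N \<and>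
        module_isomorphic (hecke0 N)
          (quotient_module (M\<lparr>carrier := Ws ! (j + 1)\<rparr>) (Ws ! j)) (simple_module (\<Gamma> ! j)))"

text \<open>
  By the Jordan-Hoelder theorem the multiset of composition factors, hence \<open>f\<close>, does not
  depend on the composition series; a module with such a series is finite-dimensional.
\<close>

definition has_qsym_char :: "nat \<Rightarrow> (free_alg set, 'b) module \<Rightarrow> qsym \<Rightarrow> bool" where
  "has_qsym_char N M f \<longleftrightarrow>
     left_module (hecke0 N) M \<and>
     (\<exists>Ws \<Gamma>. composition_series N M Ws \<Gamma> \<and> f = (\<lambda>mon. \<Sum>\<gamma>\<leftarrow>\<Gamma>. fundamental_qsym \<gamma> mon))"

end

(* Record a filling by the sequence of rows of its entries 1, 2, ... Then pi_i sorts the letters i and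
   i + 1 of this sequence, except that two equal letters are killed or fixed, depending on the
   action. Sorting satisfies the 0-Hecke relations, as one checks on two or three letters, and it
   preserves both kinds of tableaux: in each of them the larger of two entries to be compared
   lies weakly above the smaller one, so the two entries exchanged at a strict descent are never
   such a pair. Every nontrivial sorting step strictly increases the sum of row times entry.
   Ordering the tableaux by this weight gives a flag of submodules with one-dimensional
   quotients, and on the quotient of T the generator pi_i is 0 or 1 according to whether i is a
   descent of T. *)
theory Submission
  imports Defs
begin

section \<open>Coordinate spaces and the free algebra action\<close>

lemma basis_vec_expansion:
  "v = (\<Sum>b\<in>Poly_Mapping.keys v. cscale (Poly_Mapping.lookup v b) (basis_vec b))"
proof (rule poly_mapping_eqI)
  fix k
  have "Poly_Mapping.lookup (\<Sum>b\<in>Poly_Mapping.keys v. cscale (Poly_Mapping.lookup v b) (basis_vec b)) k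
     = (\<Sum>b\<in>Poly_Mapping.keys v. if k = b then Poly_Mapping.lookup v b else 0)"
    unfolding lookup_sum by (rule sum.cong) (auto simp: basis_vec_def lookup_single when_def)
  then show "Poly_Mapping.lookup v k = Poly_Mapping.lookup (\<Sum>b\<in>Poly_Mapping.keys v. cscale (Poly_Mapping.lookup v b) (basis_vec b)) k"
    by (simp add: in_keys_iff)
qed

text \<open>A bound on the support survives linear combinations, and a vector is the combination of
  the basis vectors in its support. Membership in a span is checked through this support
  condition.\<close>

lemma basis_span_iff: "v \<in> basis_span B \<longleftrightarrow> Poly_Mapping.keys v \<subseteq> B"
proof
  assume "v \<in> basis_span B"
  then show "Poly_Mapping.keys v \<subseteq> B"
    unfolding basis_span_def
  proof (induction rule: cfree.span_induct_alt)
    case base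
    then show ?case by simp
  next
    case (step c x y)
    then show ?case
      by (auto simp: in_keys_iff lookup_add basis_vec_def lookup_single when_def split: if_splits)
  qed
next
  assume "Poly_Mapping.keys v \<subseteq> B"
  then have "(\<Sum>b\<in>Poly_Mapping.keys v. cscale (Poly_Mapping.lookup v b) (basis_vec b)) \<in> basis_span B"
    unfolding basis_span_def by (intro cfree.span_sum cfree.span_scale cfree.span_base) auto
  then show "v \<in> basis_span B"
    using basis_vec_expansion[of v] by simp
qed

lemma basis_vec_in_basis_span [simp]: "basis_vec b \<in> basis_span B \<longleftrightarrow> b \<in> B"
  by (simp add: basis_span_iff basis_vec_def)

lemma basis_span_zero [simp]: "0 \<in> basis_span B"
  by (simp add: basis_span_iff)

lemma basis_span_add: "u \<in> basis_span B \<Longrightarrow> v \<in> basis_span B \<Longrightarrow> u + v \<in> basis_span B"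
  unfolding basis_span_def by (rule cfree.span_add)

lemma basis_span_uminus: "v \<in> basis_span B \<Longrightarrow> - v \<in> basis_span B"
  unfolding basis_span_def by (rule cfree.span_neg)

lemma basis_span_scale: "v \<in> basis_span B \<Longrightarrow> cscale c v \<in> basis_span B"
  unfolding basis_span_def by (rule cfree.span_scale)

lemma basis_span_sum: "(\<And>x. x \<in> A \<Longrightarrow> f x \<in> basis_span B) \<Longrightarrow> sum f A \<in> basis_span B"
  unfolding basis_span_def by (rule cfree.span_sum)

lemma basis_span_mono: "A \<subseteq> B \<Longrightarrow> basis_span A \<subseteq> basis_span B"
  by (auto simp: basis_span_iff)

text \<open>These rules take linearity as a premise, so that they apply to word actions, algebra
  actions and quotient maps without an interpretation for each map.\<close>

lemma
  assumes "Vector_Spaces.linear cscale cscale f"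
  shows linear_zero: "f 0 = 0" and linear_add: "f (u + v) = f u + f v"
    and linear_diff: "f (u - v) = f u - f v"
    and linear_scale: "f (cscale c v) = cscale c (f v)"
    and linear_sum: "f (sum g A) = (\<Sum>x\<in>A. f (g x))"
proof -
  interpret Vector_Spaces.linear cscale cscale f by fact
  show "f 0 = 0" "f (u + v) = f u + f v" "f (u - v) = f u - f v"
    "f (cscale c v) = cscale c (f v)" "f (sum g A) = (\<Sum>x\<in>A. f (g x))"
    by (simp_all add: add diff scale sum)
qed

text \<open>The source and target of \<^const>\<open>linear_ext\<close> have the same basis type; \<open>free_act\<close> is
  linear in its algebra argument, so both are instances of the following.\<close>

definition linear_comb :: "('a \<Rightarrow> 'b \<Rightarrow>\<^sub>0 complex) \<Rightarrow> ('a \<Rightarrow>\<^sub>0 complex) \<Rightarrow> 'b \<Rightarrow>\<^sub>0 complex" where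
  "linear_comb f v = (\<Sum>b\<in>Poly_Mapping.keys v. cscale (Poly_Mapping.lookup v b) (f b))"

text \<open>Coefficients vanish outside the support, so the index set may be enlarged. This lets two
  vectors be summed over a common set.\<close>

lemma linear_comb_eq_sum:
  assumes "finite A" "Poly_Mapping.keys v \<subseteq> A"
  shows "linear_comb f v = (\<Sum>b\<in>A. cscale (Poly_Mapping.lookup v b) (f b))"
  unfolding linear_comb_def using assms
  by (intro sum.mono_neutral_left) (auto simp: in_keys_iff)

lemma linear_linear_comb: "Vector_Spaces.linear cscale cscale (linear_comb f)"
proof (unfold Vector_Spaces.linear_iff, intro conjI allI)
  fix u v :: "'a \<Rightarrow>\<^sub>0 complex"
  let ?A = "Poly_Mapping.keys u \<union> Poly_Mapping.keys v"
  have "linear_comb f (u + v) = (\<Sum>b\<in>?A. cscale (Poly_Mapping.lookup (u + v) b) (f b))"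
    by (rule linear_comb_eq_sum) (use keys_add[of u v] in auto)
  also have "\<dots> = linear_comb f u + linear_comb f v"
    by (simp add: linear_comb_eq_sum[of ?A] lookup_add cfree.scale_left_distrib sum.distrib)
  finally show "linear_comb f (u + v) = linear_comb f u + linear_comb f v" .
next
  fix c and v :: "'a \<Rightarrow>\<^sub>0 complex"
  have "linear_comb f (cscale c v)
      = (\<Sum>b\<in>Poly_Mapping.keys v. cscale (Poly_Mapping.lookup (cscale c v) b) (f b))"
    by (rule linear_comb_eq_sum) (auto simp: in_keys_iff)
  then show "linear_comb f (cscale c v) = cscale c (linear_comb f v)"
    by (simp add: linear_comb_def cfree.scale_sum_right)
qed (rule cfree.vector_space_axioms)+

lemmas linear_comb_add = linear_add[OF linear_linear_comb]
  and linear_comb_diff = linear_diff[OF linear_linear_comb]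
  and linear_comb_sum = linear_sum[OF linear_linear_comb]

lemma linear_comb_single: "linear_comb f (Poly_Mapping.single b c) = cscale c (f b)"
  by (cases "c = 0") (simp_all add: linear_comb_def)

lemma linear_ext_eq_linear_comb: "linear_ext f = linear_comb f"
  by (rule ext) (simp add: linear_ext_def linear_comb_def)

lemma linear_linear_ext: "Vector_Spaces.linear cscale cscale (linear_ext f)"
  unfolding linear_ext_eq_linear_comb by (rule linear_linear_comb)

lemmas linear_ext_scale = linear_scale[OF linear_linear_ext]

lemma linear_ext_zero [simp]: "linear_ext f 0 = 0"
  by (simp add: linear_ext_def)

lemma linear_ext_basis_vec [simp]: "linear_ext f (basis_vec b) = f b"
  by (simp add: basis_vec_def linear_ext_eq_linear_comb linear_comb_single)

text \<open>Reduces identities between operators, such as the defining relations, to basis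
  vectors.\<close>

lemma linear_eqI:
  assumes "Vector_Spaces.linear cscale cscale f" "Vector_Spaces.linear cscale cscale g"
    and "\<And>b. b \<in> B \<Longrightarrow> f (basis_vec b) = g (basis_vec b)" and "v \<in> basis_span B"
  shows "f v = g v"
  using assms(4) unfolding basis_span_def
proof (induction rule: cfree.span_induct_alt)
  case base
  then show ?case
    using linear_zero[OF assms(1)] linear_zero[OF assms(2)] by simp
next
  case (step c x y)
  then show ?case
    using assms(3)
    by (auto simp: linear_add[OF assms(1)] linear_add[OF assms(2)]
      linear_scale[OF assms(1)] linear_scale[OF assms(2)])
qed

lemma linear_ext_in_basis_span:
  assumes "\<And>b. b \<in> B \<Longrightarrow> f b \<in> basis_span C" and "v \<in> basis_span B"
  shows "linear_ext f v \<in> basis_span C"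
  unfolding linear_ext_def
  by (intro basis_span_sum basis_span_scale assms(1)) (use assms(2) in \<open>auto simp: basis_span_iff\<close>)

section \<open>Actions of words and of the free algebra\<close>

abbreviation word_act :: "(nat \<Rightarrow> 'b \<Rightarrow> 'b \<Rightarrow>\<^sub>0 complex) \<Rightarrow> nat list \<Rightarrow> ('b \<Rightarrow>\<^sub>0 complex) \<Rightarrow> 'b \<Rightarrow>\<^sub>0 complex"
  where "word_act p w \<equiv> foldr (\<lambda>i. linear_ext (p i)) w"

lemma linear_word_act: "Vector_Spaces.linear cscale cscale (word_act p w)"
proof (induction w)
  case Nil
  then show ?case by (simp add: cfree.linear_id[unfolded id_def] id_def)
next
  case (Cons i w)
  from Vector_Spaces.linear_compose[OF this linear_linear_ext] show ?case
    by (simp add: comp_def)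
qed

lemma free_act_eq_linear_comb: "free_act p a v = linear_comb (\<lambda>w. word_act p w v) a"
  by (simp add: free_act_def linear_comb_def)

lemma linear_free_act: "Vector_Spaces.linear cscale cscale (free_act p a)"
  unfolding Vector_Spaces.linear_iff
  by (auto simp: free_act_def linear_add[OF linear_word_act]
      linear_scale[OF linear_word_act] cfree.scale_right_distrib sum.distrib
      cfree.scale_sum_right mult.commute cfree.vector_space_axioms)

lemma free_act_add: "free_act p (a + b) v = free_act p a v + free_act p b v"
  by (simp add: free_act_eq_linear_comb linear_comb_add)

lemma free_act_diff: "free_act p (a - b) v = free_act p a v - free_act p b v"
  by (simp add: free_act_eq_linear_comb linear_comb_diff)

lemma free_act_sum: "free_act p (sum f A) v = (\<Sum>x\<in>A. free_act p (f x) v)"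
  by (simp add: free_act_eq_linear_comb linear_comb_sum)

lemma free_act_single: "free_act p (Poly_Mapping.single w c) v = cscale c (word_act p w v)"
  by (simp add: free_act_eq_linear_comb linear_comb_single)

lemma single_expansion:
  fixes a :: "'a \<Rightarrow>\<^sub>0 complex"
  shows "a = (\<Sum>w\<in>Poly_Mapping.keys a. Poly_Mapping.single w (Poly_Mapping.lookup a w))"
proof -
  have "cscale c (basis_vec w) = Poly_Mapping.single w c" for c :: complex and w :: 'a
    by (rule poly_mapping_eqI) (simp add: basis_vec_def lookup_single when_def)
  then show ?thesis
    using basis_vec_expansion[of a] by simp
qed

text \<open>Expanding both factors into monomials leaves the product of two words. It is their
  concatenation, which \<open>foldr\<close> turns into composition of operators.\<close>

lemma free_act_mult: "free_act p (a * b) v = free_act p a (free_act p b v)"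
proof -
  have "free_act p (Poly_Mapping.single u c * b) v = cscale c (word_act p u (free_act p b v))" for u c
  proof -
    have "Poly_Mapping.single u c * b
        = (\<Sum>w\<in>Poly_Mapping.keys b. Poly_Mapping.single (u @ w) (c * Poly_Mapping.lookup b w))"
      \<comment> \<open>Only the first occurrence is expanded, since \<open>b\<close> occurs again
        in the coefficients and supports.\<close>
      by (subst (1) single_expansion[of b]) (simp add: sum_distrib_left mult_single plus_list_def)
    then show ?thesis
      by (simp add: free_act_sum free_act_single free_act_def[of p b] linear_sum[OF linear_word_act]
          linear_scale[OF linear_word_act] cfree.scale_sum_right)
  qed
  note * = this
  have "a * b = (\<Sum>u\<in>Poly_Mapping.keys a. Poly_Mapping.single u (Poly_Mapping.lookup a u) * b)"
    by (subst (1) single_expansion[of a]) (simp add: sum_distrib_right)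
  then show ?thesis
    by (simp add: free_act_sum * free_act_def[of p a])
qed

lemma free_act_one [simp]: "free_act p 1 v = v"
  by (simp flip: single_one add: free_act_single zero_list_def)

lemma free_act_gen [simp]: "free_act p (gen i) v = linear_ext (p i) v"
  by (simp add: gen_def free_act_single)

section \<open>Modules over the 0-Hecke algebra\<close>

lemma keys_uminus: "Poly_Mapping.keys (- (a :: 'a \<Rightarrow>\<^sub>0 'b::ab_group_add)) = Poly_Mapping.keys a"
  by (auto simp: in_keys_iff)

lemma free_algebra_simps [simp]:
  "a \<in> carrier (free_algebra N) \<longleftrightarrow> Poly_Mapping.keys a \<subseteq> lists {1..<N}"
  "a \<otimes>\<^bsub>free_algebra N\<^esub> b = a * b" "\<one>\<^bsub>free_algebra N\<^esub> = 1"
  "\<zero>\<^bsub>free_algebra N\<^esub> = 0" "a \<oplus>\<^bsub>free_algebra N\<^esub> b = a + b"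
  by (simp_all add: free_algebra_def)

lemma free_algebra_add_closed:
  "a \<in> carrier (free_algebra N) \<Longrightarrow> b \<in> carrier (free_algebra N) \<Longrightarrow> a + b \<in> carrier (free_algebra N)"
  using keys_add[of a b] by auto

lemma free_algebra_mult_closed:
  "a \<in> carrier (free_algebra N) \<Longrightarrow> b \<in> carrier (free_algebra N) \<Longrightarrow> a * b \<in> carrier (free_algebra N)"
  using keys_mult[of a b] by (fastforce simp: plus_list_def)

lemma free_algebra_uminus_closed:
  "a \<in> carrier (free_algebra N) \<Longrightarrow> - a \<in> carrier (free_algebra N)"
  by (simp add: keys_uminus)

lemma gen_in_free_algebra: "i \<in> {1..<N} \<Longrightarrow> gen i \<in> carrier (free_algebra N)"
  by (simp add: gen_def)

lemma ring_free_algebra: "ring (free_algebra N)"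
proof (intro ringI abelian_groupI Group.monoidI)
  fix x assume "x \<in> carrier (free_algebra N)"
  then show "\<exists>y\<in>carrier (free_algebra N). y \<oplus>\<^bsub>free_algebra N\<^esub> x = \<zero>\<^bsub>free_algebra N\<^esub>"
    by (intro bexI[of _ "- x"]) (simp_all add: keys_uminus)
qed (use free_algebra_add_closed free_algebra_mult_closed in
    \<open>simp_all add: algebra_simps zero_list_def\<close>)

lemma free_algebra_a_inv:
  assumes "a \<in> carrier (free_algebra N)"
  shows "\<ominus>\<^bsub>free_algebra N\<^esub> a = - a"
proof -
  interpret ring "free_algebra N" by (rule ring_free_algebra)
  show ?thesis
    using assms by (intro minus_equality) (simp_all add: keys_uminus)
qed

lemma hecke_relators_subset: "hecke_relators N \<subseteq> carrier (free_algebra N)"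
proof -
  have diff: "a - b \<in> carrier (free_algebra N)"
    if "a \<in> carrier (free_algebra N)" "b \<in> carrier (free_algebra N)" for a b
    using free_algebra_add_closed[OF that(1) free_algebra_uminus_closed[OF that(2)]] by simp
  show ?thesis
    unfolding hecke_relators_def
    by (auto simp del: free_algebra_simps intro!: diff free_algebra_mult_closed gen_in_free_algebra)
qed

abbreviation hecke_ideal :: "nat \<Rightarrow> free_alg set" where
  "hecke_ideal N \<equiv> Idl\<^bsub>free_algebra N\<^esub> (hecke_relators N)"

lemma ideal_hecke_ideal: "ideal (hecke_ideal N) (free_algebra N)"
  by (intro ring.genideal_ideal ring_free_algebra hecke_relators_subset)

lemma ring_hecke0: "ring (hecke0 N)"
  unfolding hecke0_def by (intro ideal.quotient_is_ring ideal_hecke_ideal)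

abbreviation hecke_class :: "nat \<Rightarrow> free_alg \<Rightarrow> free_alg set" where
  "hecke_class N a \<equiv> hecke_ideal N +>\<^bsub>free_algebra N\<^esub> a"

lemma hecke_class_eq: "hecke_class N a = (\<lambda>h. h + a) ` hecke_ideal N"
  by (auto simp: a_r_coset_def')

lemma hecke_class_self:
  assumes "a \<in> carrier (free_algebra N)"
  shows "a \<in> hecke_class N a"
proof -
  interpret ideal "hecke_ideal N" "free_algebra N" by (rule ideal_hecke_ideal)
  show ?thesis using assms by (rule a_rcos_self)
qed

lemma carrier_hecke0: "carrier (hecke0 N) = hecke_class N ` carrier (free_algebra N)"
  by (auto simp: hecke0_def FactRing_def A_RCOSETS_def')

lemma carrier_hecke0E:
  assumes "X \<in> carrier (hecke0 N)"
  obtains a where "a \<in> carrier (free_algebra N)" "X = hecke_class N a"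
  using assms by (auto simp: carrier_hecke0 simp del: free_algebra_simps)

lemma
  assumes "a \<in> carrier (free_algebra N)" "b \<in> carrier (free_algebra N)"
  shows hecke0_add: "hecke_class N a \<oplus>\<^bsub>hecke0 N\<^esub> hecke_class N b = hecke_class N (a + b)"
    and hecke0_mult: "hecke_class N a \<otimes>\<^bsub>hecke0 N\<^esub> hecke_class N b = hecke_class N (a * b)"
proof -
  interpret ideal "hecke_ideal N" "free_algebra N" by (rule ideal_hecke_ideal)
  show "hecke_class N a \<oplus>\<^bsub>hecke0 N\<^esub> hecke_class N b = hecke_class N (a + b)"
    using a_rcos_sum[OF assms] by (simp add: hecke0_def FactRing_def)
  show "hecke_class N a \<otimes>\<^bsub>hecke0 N\<^esub> hecke_class N b = hecke_class N (a * b)"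
    using rcoset_mult_add[OF assms] by (simp add: hecke0_def FactRing_def)
qed

lemma hecke0_one: "\<one>\<^bsub>hecke0 N\<^esub> = hecke_class N 1"
  by (simp add: hecke0_def FactRing_def)

text \<open>Operators prescribed on a basis and satisfying the 0-Hecke relations there. The
  innermost application is written \<open>p i b\<close> because it acts on a basis vector.
  Commutation is asked for one order of the indices; the other order is its mirror image.\<close>

locale hecke_rep =
  fixes N :: nat and B :: "'b set" and p :: "nat \<Rightarrow> 'b \<Rightarrow> 'b \<Rightarrow>\<^sub>0 complex"
  assumes closed: "i \<in> {1..<N} \<Longrightarrow> b \<in> B \<Longrightarrow> p i b \<in> basis_span B"
    and idem: "i \<in> {1..<N} \<Longrightarrow> b \<in> B \<Longrightarrow> linear_ext (p i) (p i b) = p i b"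
    and braid: "i \<in> {1..<N} \<Longrightarrow> i + 1 \<in> {1..<N} \<Longrightarrow> b \<in> B \<Longrightarrow>
      linear_ext (p i) (linear_ext (p (i + 1)) (p i b)) =
      linear_ext (p (i + 1)) (linear_ext (p i) (p (i + 1) b))"
    and far: "i \<in> {1..<N} \<Longrightarrow> j \<in> {1..<N} \<Longrightarrow> i + 2 \<le> j \<Longrightarrow> b \<in> B \<Longrightarrow>
      linear_ext (p i) (p j b) = linear_ext (p j) (p i b)"
begin

lemma word_act_closed:
  "w \<in> lists {1..<N} \<Longrightarrow> v \<in> basis_span B \<Longrightarrow> word_act p w v \<in> basis_span B"
proof (induction w)
  case (Cons i w)
  then show ?case
    using linear_ext_in_basis_span[of B "p i" B] closed by simp
qed simp

lemma free_act_closed: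
  "a \<in> carrier (free_algebra N) \<Longrightarrow> v \<in> basis_span B \<Longrightarrow> free_act p a v \<in> basis_span B"
  unfolding free_act_def by (intro basis_span_sum basis_span_scale word_act_closed) auto

text \<open>Each relator is a difference of two elements whose actions agree on \<open>B\<close> by
  a locale assumption, hence on the span by linearity.\<close>

lemma hecke_relators_act_zero:
  assumes "r \<in> hecke_relators N" "v \<in> basis_span B"
  shows "free_act p r v = 0"
proof -
  have "free_act p (a - b) v = 0"
    if "\<And>x. x \<in> B \<Longrightarrow> free_act p a (basis_vec x) = free_act p b (basis_vec x)" for a b
    using linear_eqI[OF linear_free_act linear_free_act that assms(2)] by (simp add: free_act_diff)
  moreover have "\<exists>a b. r = a - b \<and> (\<forall>x\<in>B. free_act p a (basis_vec x) = free_act p b (basis_vec x))"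
    using assms(1) unfolding hecke_relators_def
  proof (elim UnE CollectE exE conjE)
    fix i assume "r = gen i * gen i - gen i" "i \<in> {1..<N}"
    then show ?thesis
      using idem by (intro exI[of _ "gen i * gen i"] exI[of _ "gen i"]) (simp add: free_act_mult)
  next
    fix i assume "r = gen i * gen (i + 1) * gen i - gen (i + 1) * gen i * gen (i + 1)"
      "i \<in> {1..<N}" "i + 1 \<in> {1..<N}"
    then show ?thesis
      using braid by (intro exI[of _ "gen i * gen (i + 1) * gen i"]
        exI[of _ "gen (i + 1) * gen i * gen (i + 1)"]) (simp add: free_act_mult)
  next
    fix i j assume "r = gen i * gen j - gen j * gen i" "i \<in> {1..<N}" "j \<in> {1..<N}"
      "i + 2 \<le> j \<or> j + 2 \<le> i"
    then show ?thesis
      using far[of i j] far[of j i]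
      by (intro exI[of _ "gen i * gen j"] exI[of _ "gen j * gen i"]) (auto simp: free_act_mult)
  qed
  ultimately show ?thesis by blast
qed

text \<open>The annihilator of the span is a two-sided ideal containing the relators, so it contains
  the ideal they generate.\<close>

lemma hecke_ideal_act_zero:
  assumes "a \<in> hecke_ideal N" "v \<in> basis_span B"
  shows "free_act p a v = 0"
proof -
  interpret ring "free_algebra N" by (rule ring_free_algebra)
  define K where "K = {a \<in> carrier (free_algebra N). \<forall>v\<in>basis_span B. free_act p a v = 0}"
  have "ideal K (free_algebra N)"
  proof (rule idealI)
    show "subgroup K (add_monoid (free_algebra N))"
    proof (rule add.subgroupI)
      show "K \<noteq> {}" by (auto simp: K_def free_act_def intro!: exI[of _ 0])
      fix a assume a: "a \<in> K"
      \<comment> \<open>The negative is written as a difference so that \<open>free_act_diff\<close>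
        applies.\<close>
      then have "free_act p (0 - a) v = 0" if "v \<in> basis_span B" for v
        unfolding free_act_diff using that by (simp add: K_def free_act_def[of p 0])
      with a show "\<ominus>\<^bsub>free_algebra N\<^esub> a \<in> K"
        by (auto simp: K_def free_algebra_a_inv keys_uminus)
    next
      fix a b assume "a \<in> K" "b \<in> K"
      then show "a \<oplus>\<^bsub>free_algebra N\<^esub> b \<in> K"
        using free_algebra_add_closed[of a N b] by (simp add: K_def free_act_add)
    qed (auto simp: K_def)
  next
    fix a x assume ax: "a \<in> K" "x \<in> carrier (free_algebra N)"
    then show "x \<otimes>\<^bsub>free_algebra N\<^esub> a \<in> K" 
      using free_algebra_mult_closed[of x N a]
      by (simp add: K_def free_act_mult linear_zero[OF linear_free_act])
    \<comment> \<open>Here \<open>x\<close> acts first, so the span must be stable under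
      \<open>x\<close> before \<open>a\<close> can annihilate the result.\<close>
    show "a \<otimes>\<^bsub>free_algebra N\<^esub> x \<in> K"
      using ax free_algebra_mult_closed[of a N x] free_act_closed[of x]
      by (simp add: K_def free_act_mult)
  qed (rule ring_axioms)
  moreover have "hecke_relators N \<subseteq> K"
    using hecke_relators_subset hecke_relators_act_zero by (auto simp: K_def simp del: free_algebra_simps)
  ultimately have "hecke_ideal N \<subseteq> K" by (rule genideal_minimal)
  with assms show ?thesis by (auto simp: K_def)
qed

text \<open>Representatives of a class differ by an element of the ideal, which acts as zero, so
  they all act alike. Since the class contains \<open>a\<close>, the common value is unique and the
  description is proper.\<close>

lemma hecke_act_class:
  assumes "a \<in> carrier (free_algebra N)" "v \<in> basis_span B"
  shows "hecke_act p (hecke_class N a) v = free_act p a v"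
  unfolding hecke_act_def
proof (rule the_equality)
  show "\<forall>c\<in>hecke_class N a. free_act p c v = free_act p a v"
    by (simp add: hecke_class_eq free_act_add hecke_ideal_act_zero assms)
  then show "u = free_act p a v" if "\<forall>c\<in>hecke_class N a. free_act p c v = u" for u
    using that hecke_class_self[OF assms(1)] by auto
qed

lemma hecke_act_closed:
  "X \<in> carrier (hecke0 N) \<Longrightarrow> v \<in> basis_span B \<Longrightarrow> hecke_act p X v \<in> basis_span B"
  by (erule carrier_hecke0E) (simp add: hecke_act_class free_act_closed del: free_algebra_simps)

end

section \<open>The left module of a representation, and its submodules\<close>

lemma hecke_module_simps [simp]:
  "carrier (hecke_module B p) = basis_span B" "\<zero>\<^bsub>hecke_module B p\<^esub> = 0"
  "u \<oplus>\<^bsub>hecke_module B p\<^esub> v = u + v" "X \<odot>\<^bsub>hecke_module B p\<^esub> v = hecke_act p X v"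
  "(hecke_module B p)\<lparr>carrier := basis_span B'\<rparr> = hecke_module B' p"
  by (simp_all add: hecke_module_def)

lemma abelian_group_hecke_module: "abelian_group (hecke_module B p)"
proof (rule abelian_groupI)
  fix x assume "x \<in> carrier (hecke_module B p)"
  then show "\<exists>y\<in>carrier (hecke_module B p). y \<oplus>\<^bsub>hecke_module B p\<^esub> x = \<zero>\<^bsub>hecke_module B p\<^esub>"
    by (intro bexI[of _ "- x"]) (simp_all add: basis_span_uminus)
qed (simp_all add: basis_span_add algebra_simps)

lemma hecke_module_a_inv:
  assumes "v \<in> basis_span B"
  shows "\<ominus>\<^bsub>hecke_module B p\<^esub> v = - v"
proof -
  interpret abelian_group "hecke_module B p" by (rule abelian_group_hecke_module)
  show ?thesis
    using assms by (intro minus_equality) (simp_all add: basis_span_uminus)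
qed

context hecke_rep
begin

lemma left_module_hecke_module: "left_module (hecke0 N) (hecke_module B p)"
proof (intro left_module.intro left_module_axioms.intro)
  show "ring (hecke0 N)" by (rule ring_hecke0)
  show "abelian_group (hecke_module B p)" by (rule abelian_group_hecke_module)
  fix X assume X: "X \<in> carrier (hecke0 N)"
  then obtain a where a: "a \<in> carrier (free_algebra N)" "X = hecke_class N a"
    by (rule carrier_hecke0E)
  fix v assume "v \<in> carrier (hecke_module B p)"
  then have v: "v \<in> basis_span B" by simp
  show "X \<odot>\<^bsub>hecke_module B p\<^esub> v \<in> carrier (hecke_module B p)"
    using hecke_act_closed X v by simp
  show "X \<odot>\<^bsub>hecke_module B p\<^esub> (v \<oplus>\<^bsub>hecke_module B p\<^esub> u) =
      X \<odot>\<^bsub>hecke_module B p\<^esub> v \<oplus>\<^bsub>hecke_module B p\<^esub> X \<odot>\<^bsub>hecke_module B p\<^esub> u"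
    if "u \<in> carrier (hecke_module B p)" for u
    using that v a(1)
    by (simp add: a(2) hecke_act_class basis_span_add linear_add[OF linear_free_act] del: free_algebra_simps)
  fix Y assume "Y \<in> carrier (hecke0 N)"
  then obtain b where b: "b \<in> carrier (free_algebra N)" "Y = hecke_class N b"
    by (rule carrier_hecke0E)
  show "(X \<oplus>\<^bsub>hecke0 N\<^esub> Y) \<odot>\<^bsub>hecke_module B p\<^esub> v =
      X \<odot>\<^bsub>hecke_module B p\<^esub> v \<oplus>\<^bsub>hecke_module B p\<^esub> Y \<odot>\<^bsub>hecke_module B p\<^esub> v"
    using v a(1) b(1) free_algebra_add_closed[OF a(1) b(1)]
    by (simp add: a(2) b(2) hecke0_add hecke_act_class free_act_add del: free_algebra_simps)
  show "(X \<otimes>\<^bsub>hecke0 N\<^esub> Y) \<odot>\<^bsub>hecke_module B p\<^esub> v =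
      X \<odot>\<^bsub>hecke_module B p\<^esub> (Y \<odot>\<^bsub>hecke_module B p\<^esub> v)"
    using v a(1) b(1) free_algebra_mult_closed[OF a(1) b(1)]
    by (simp add: a(2) b(2) hecke0_mult hecke_act_class free_act_mult free_act_closed del: free_algebra_simps)
next
  fix v assume "v \<in> carrier (hecke_module B p)"
  moreover have "1 \<in> carrier (free_algebra N)" by (simp add: zero_list_def)
  ultimately show "\<one>\<^bsub>hecke0 N\<^esub> \<odot>\<^bsub>hecke_module B p\<^esub> v = v"
    by (simp add: hecke0_one hecke_act_class del: free_algebra_simps)
qed

text \<open>The relations are inherited from \<open>B\<close>, so stability is all that is left to
  check.\<close>

lemma hecke_rep_subset:
  assumes "A \<subseteq> B" "\<And>i b. i \<in> {1..<N} \<Longrightarrow> b \<in> A \<Longrightarrow> p i b \<in> basis_span A"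
  shows "hecke_rep N A p"
  by (rule hecke_rep.intro) (use assms idem braid far in blast)+

end

lemma submodule_hecke_module:
  assumes "hecke_rep N A p" "A \<subseteq> B"
  shows "submodule (basis_span A) (hecke0 N) (hecke_module B p)"
proof -
  interpret hecke_rep N A p by fact
  interpret M: abelian_group "hecke_module B p" by (rule abelian_group_hecke_module)
  have "subgroup (basis_span A) (add_monoid (hecke_module B p))"
  proof (rule M.add.subgroupI)
    fix v assume v: "v \<in> basis_span A"
    then have "v \<in> basis_span B" using basis_span_mono[OF assms(2)] by blast
    with v show "\<ominus>\<^bsub>hecke_module B p\<^esub> v \<in> basis_span A"
      by (simp add: hecke_module_a_inv basis_span_uminus)
  qed (use basis_span_mono[OF assms(2)] in \<open>auto intro: basis_span_add exI[of _ 0] simp: ex_in_conv[symmetric]\<close>)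
  then show ?thesis
    by (intro submodule.intro submodule_axioms.intro) (simp_all add: hecke_act_closed)
qed

section \<open>Composition series from triangular actions\<close>

text \<open>Commuting with generators extends to words by induction, to the free algebra by
  linearity, and to classes because on both sides a class acts as its representative.\<close>

lemma linear_intertwines_hecke_act:
  assumes "hecke_rep N A p" "hecke_rep N C q" and lin: "Vector_Spaces.linear cscale cscale \<phi>"
    and maps: "\<phi> ` basis_span A \<subseteq> basis_span C"
    and gens: "\<And>i b. i \<in> {1..<N} \<Longrightarrow> b \<in> A \<Longrightarrow> \<phi> (p i b) = linear_ext (q i) (\<phi> (basis_vec b))"
    and X: "X \<in> carrier (hecke0 N)" and v: "v \<in> basis_span A"
  shows "\<phi> (hecke_act p X v) = hecke_act q X (\<phi> v)"
proof -
  interpret A: hecke_rep N A p by fact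
  interpret C: hecke_rep N C q by fact
  have step: "\<phi> (linear_ext (p i) u) = linear_ext (q i) (\<phi> u)" if "i \<in> {1..<N}" "u \<in> basis_span A" for i u
    using linear_eqI[OF Vector_Spaces.linear_compose[OF linear_linear_ext lin]
        Vector_Spaces.linear_compose[OF lin linear_linear_ext] _ that(2), of "p i" "q i"]
      gens that(1) by simp
  have word: "\<phi> (word_act p w v) = word_act q w (\<phi> v)" if "w \<in> lists {1..<N}" for w
    using that
  proof (induction w)
    case (Cons i w)
    then show ?case using step[of i "word_act p w v"] A.word_act_closed[of w v] v by simp
  qed simp
  obtain a where a: "a \<in> carrier (free_algebra N)" "X = hecke_class N a"
    using X by (rule carrier_hecke0E)
  have "\<phi> (free_act p a v) = free_act q a (\<phi> v)"
    unfolding free_act_def linear_sum[OF lin] linear_scale[OF lin]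
    using a(1) by (intro sum.cong refl arg_cong[of _ _ "cscale _"] word) auto
  moreover have "\<phi> v \<in> basis_span C" using maps v by blast
  ultimately show ?thesis
    using a v by (simp add: A.hecke_act_class C.hecke_act_class del: free_algebra_simps)
qed

text \<open>The first isomorphism theorem, with equivariance required on generators and basis
  vectors only.\<close>

lemma hecke_quotient_isomorphic:
  assumes A: "hecke_rep N A p" and C: "hecke_rep N C q" and lin: "Vector_Spaces.linear cscale cscale \<phi>"
    and onto: "\<phi> ` basis_span A = basis_span C"
    and kernel: "\<And>v. v \<in> basis_span A \<Longrightarrow> \<phi> v = 0 \<longleftrightarrow> v \<in> basis_span A0" and sub: "A0 \<subseteq> A"
    and gens: "\<And>i b. i \<in> {1..<N} \<Longrightarrow> b \<in> A \<Longrightarrow> \<phi> (p i b) = linear_ext (q i) (\<phi> (basis_vec b))"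
  shows "module_isomorphic (hecke0 N)
    (quotient_module (hecke_module A p) (basis_span A0)) (hecke_module C q)"
proof -
  interpret A: hecke_rep N A p by fact
  define W where "W = basis_span A0"
  define M where "M = hecke_module A p"
  \<comment> \<open>The choice of representative is harmless: \<open>\<phi>_coset\<close> below
    shows that \<open>\<phi>\<close> is constant on cosets.\<close>
  define f where "f X = \<phi> (SOME x. x \<in> X)" for X
  have WA: "W \<subseteq> basis_span A" unfolding W_def by (rule basis_span_mono[OF sub])
  have f_eqI: "f X = u" if "x \<in> X" "\<And>y. y \<in> X \<Longrightarrow> \<phi> y = u" for X x u
    using that unfolding f_def by (metis someI)
  have coset: "W +>\<^bsub>M\<^esub> x = (\<lambda>w. w + x) ` W" for x
    by (auto simp: a_r_coset_def' M_def)
  have self: "x \<in> W +>\<^bsub>M\<^esub> x" for x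
    unfolding coset by (rule image_eqI[of _ _ 0]) (simp_all add: W_def)
  have \<phi>_coset: "\<phi> y = \<phi> x" if y: "y \<in> W +>\<^bsub>M\<^esub> x" for x y
  proof -
    obtain w where w: "w \<in> W" "y = w + x" using y unfolding coset by blast
    then have "\<phi> w = 0" using kernel[of w] WA by (simp add: W_def subset_iff)
    then show ?thesis using w(2) by (simp add: linear_add[OF lin])
  qed
  have f_coset: "f (W +>\<^bsub>M\<^esub> x) = \<phi> x" for x
    by (rule f_eqI[OF self \<phi>_coset])
  let ?Q = "quotient_module M W"
  have car: "carrier ?Q = (\<lambda>x. W +>\<^bsub>M\<^esub> x) ` basis_span A"
    by (auto simp: quotient_module_def A_RCOSETS_def' M_def)
  have eq: "W +>\<^bsub>M\<^esub> x = W +>\<^bsub>M\<^esub> y"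
    if "x \<in> basis_span A" "y \<in> basis_span A" "\<phi> x = \<phi> y" for x y
  proof -
    \<comment> \<open>One inclusion suffices, as the assumptions are symmetric in \<open>x\<close>
      and \<open>y\<close>.\<close>
    have sub: "W +>\<^bsub>M\<^esub> x \<subseteq> W +>\<^bsub>M\<^esub> y"
      if "x \<in> basis_span A" "y \<in> basis_span A" "\<phi> x = \<phi> y" for x y
    proof -
      have "x - y \<in> W"
        using kernel[of "x - y"] basis_span_add[OF that(1) basis_span_uminus[OF that(2)]] that(3)
        by (simp add: linear_diff[OF lin] W_def)
      \<comment> \<open>The witness comes from \<open>w + x = (w + (x - y)) + y\<close>.\<close>
      then show ?thesis
        unfolding coset by (auto simp: W_def intro!: image_eqI[of _ _ "_ + (x - y)"] basis_span_add)
    qed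
    show ?thesis using sub[OF that] sub[OF that(2,1) that(3)[symmetric]] by (rule equalityI)
  qed
  have "bij_betw f (carrier ?Q) (basis_span C)"
    unfolding bij_betw_def
  proof
    show "inj_on f (carrier ?Q)"
    proof (rule inj_onI)
      fix X Y assume "X \<in> carrier ?Q" "Y \<in> carrier ?Q" and f: "f X = f Y"
      then obtain x y where xy: "x \<in> basis_span A" "X = W +>\<^bsub>M\<^esub> x"
        "y \<in> basis_span A" "Y = W +>\<^bsub>M\<^esub> y"
        unfolding car by blast
      then have "\<phi> x = \<phi> y" using f f_coset by simp
      then show "X = Y" unfolding xy(2,4) by (rule eq[OF xy(1,3)])
    qed
    show "f ` carrier ?Q = basis_span C" by (simp add: car image_image f_coset onto)
  qed
  moreover have "f (X \<oplus>\<^bsub>?Q\<^esub> Y) = f X + f Y" if XY: "X \<in> carrier ?Q" "Y \<in> carrier ?Q" for X Y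
  proof -
    obtain x y where x: "X = W +>\<^bsub>M\<^esub> x" and y: "Y = W +>\<^bsub>M\<^esub> y"
      using XY by (auto simp: car)
    have plus: "X \<oplus>\<^bsub>?Q\<^esub> Y = {u + v |u v. u \<in> X \<and> v \<in> Y}"
      by (auto simp: quotient_module_def set_add_def' M_def)
    have "f (X \<oplus>\<^bsub>?Q\<^esub> Y) = \<phi> x + \<phi> y"
    proof (rule f_eqI)
      show "x + y \<in> X \<oplus>\<^bsub>?Q\<^esub> Y" unfolding plus using self[of x] self[of y] x y by blast
      fix z assume "z \<in> X \<oplus>\<^bsub>?Q\<^esub> Y"
      then obtain u v where uv: "z = u + v" "u \<in> X" "v \<in> Y" unfolding plus by blast
      then have "\<phi> u = \<phi> x" "\<phi> v = \<phi> y" using \<phi>_coset x y by blast+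
      then show "\<phi> z = \<phi> x + \<phi> y" by (simp add: uv(1) linear_add[OF lin])
    qed
    then show ?thesis by (simp add: x y f_coset)
  qed
  moreover have "f (a \<odot>\<^bsub>?Q\<^esub> X) = hecke_act q a (f X)"
    if a: "a \<in> carrier (hecke0 N)" and XQ: "X \<in> carrier ?Q" for a X
  proof -
    obtain x where x: "x \<in> basis_span A" "X = W +>\<^bsub>M\<^esub> x"
      using XQ by (auto simp: car)
    \<comment> \<open>The scalar multiple is a union over all representatives \<open>z\<close>;
      \<open>act\<close> below shows that \<open>\<phi>\<close> takes a single value on it.\<close>
    have smult: "a \<odot>\<^bsub>?Q\<^esub> X = (\<Union>z\<in>X. W +>\<^bsub>M\<^esub> hecke_act p a z)"
      by (simp add: quotient_module_def M_def)
    have XA: "X \<subseteq> basis_span A"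
      using x WA by (auto simp: coset intro: basis_span_add)
    have act: "\<phi> (hecke_act p a z) = hecke_act q a (\<phi> x)" if z: "z \<in> X" for z
    proof -
      have "\<phi> z = \<phi> x" using z unfolding x(2) by (rule \<phi>_coset)
      moreover have "z \<in> basis_span A" using z XA by blast
      ultimately show ?thesis
        using linear_intertwines_hecke_act[OF A C lin _ gens a, of z] onto by simp
    qed
    have "f (a \<odot>\<^bsub>?Q\<^esub> X) = hecke_act q a (\<phi> x)"
    proof (rule f_eqI)
      have "x \<in> X" unfolding x(2) by (rule self)
      then show "hecke_act p a x \<in> a \<odot>\<^bsub>?Q\<^esub> X"
        unfolding smult using self by blast
      fix y assume "y \<in> a \<odot>\<^bsub>?Q\<^esub> X"
      then obtain z where "z \<in> X" "y \<in> W +>\<^bsub>M\<^esub> hecke_act p a z" unfolding smult by blast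
      then show "\<phi> y = hecke_act q a (\<phi> x)" using \<phi>_coset[of y] act by simp
    qed
    then show ?thesis by (simp add: x f_coset)
  qed
  ultimately show ?thesis
    unfolding module_isomorphic_def M_def W_def by auto
qed

lemma hecke_rep_simple: "hecke_rep N {\<gamma>} (\<lambda>i v. if i \<in> set_of_comp \<gamma> then 0 else basis_vec v)"
  by unfold_locales auto

text \<open>The quotient is a line spanned by the image of \<open>b\<close>. Modulo the span of
  \<open>A\<close> a generator kills \<open>b\<close> or fixes it, just as it does the basis vector
  of the simple module.\<close>

lemma hecke_quotient_simple:
  assumes A: "hecke_rep N (insert b A) p" and "b \<notin> A"
    and stable: "\<And>i c. i \<in> {1..<N} \<Longrightarrow> c \<in> A \<Longrightarrow> p i c \<in> basis_span A"
    and des: "\<And>i. i \<in> {1..<N} \<Longrightarrow> i \<in> set_of_comp \<gamma> \<Longrightarrow> p i b \<in> basis_span A"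
    and asc: "\<And>i. i \<in> {1..<N} \<Longrightarrow> i \<notin> set_of_comp \<gamma> \<Longrightarrow> p i b = basis_vec b"
  shows "module_isomorphic (hecke0 N)
    (quotient_module (hecke_module (insert b A) p) (basis_span A)) (simple_module \<gamma>)"
proof -
  \<comment> \<open>The coordinate at \<open>b\<close>, placed in the simple module; on the larger
    span its kernel is the span of \<open>A\<close>.\<close>
  define \<phi> :: "('a \<Rightarrow>\<^sub>0 complex) \<Rightarrow> nat list \<Rightarrow>\<^sub>0 complex"
    where "\<phi> v = cscale (Poly_Mapping.lookup v b) (basis_vec \<gamma>)" for v
  have lin: "Vector_Spaces.linear cscale cscale \<phi>"
    by (auto simp: Vector_Spaces.linear_iff \<phi>_def lookup_add cfree.scale_left_distrib
      cfree.vector_space_axioms)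
  have basis_nz: "basis_vec \<gamma> \<noteq> 0"
    by (metis basis_vec_def lookup_single_eq lookup_zero zero_neq_one)
  have \<phi>0: "\<phi> v = 0" if "v \<in> basis_span A" for v
    using that \<open>b \<notin> A\<close> by (auto simp: \<phi>_def basis_span_iff in_keys_iff subset_iff)
  have \<phi>_basis: "\<phi> (basis_vec c) = (if c = b then basis_vec \<gamma> else 0)" for c
    by (simp add: \<phi>_def basis_vec_def lookup_single when_def)
  show ?thesis
    unfolding simple_module_def
  proof (rule hecke_quotient_isomorphic[OF A hecke_rep_simple lin])
    show "\<phi> ` basis_span (insert b A) = basis_span {\<gamma>}"
    proof (intro equalityI subsetI)
      fix v assume v: "v \<in> basis_span {\<gamma>}"
      then have "v = \<phi> (cscale (Poly_Mapping.lookup v \<gamma>) (basis_vec b))"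
        by (auto intro!: poly_mapping_eqI simp: \<phi>_def basis_vec_def lookup_single when_def basis_span_iff in_keys_iff subset_iff)
      then show "v \<in> \<phi> ` basis_span (insert b A)"
        by (auto intro!: basis_span_scale image_eqI)
    qed (auto simp: \<phi>_def intro!: basis_span_scale)
    show "\<phi> v = 0 \<longleftrightarrow> v \<in> basis_span A" if "v \<in> basis_span (insert b A)" for v
      using that \<phi>0[of v] basis_nz by (auto simp: \<phi>_def basis_span_iff in_keys_iff)
    show "\<phi> (p i c) = linear_ext (\<lambda>v. if i \<in> set_of_comp \<gamma> then 0 else basis_vec v) (\<phi> (basis_vec c))"
      if "i \<in> {1..<N}" "c \<in> insert b A" for i c
      using that des asc stable[of i c] \<phi>0 \<open>b \<notin> A\<close> by (auto simp: \<phi>_basis)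
  qed auto
qed

section \<open>Compositions and descent sets determine each other\<close>

lemma
  assumes "S \<subseteq> {1..<N}"
  shows composition_comp_of_set: "composition (comp_of_set N S) N"
    and set_of_comp_of_set: "set_of_comp (comp_of_set N S) = S"
proof -
  have "composition (comp_of_set N S) N \<and> set_of_comp (comp_of_set N S) = S"
  proof (cases "N = 0")
    case True
    then show ?thesis using assms by (simp add: comp_of_set_def composition_def set_of_comp_def)
  next
    case False
    define xs where "xs = sorted_list_of_set S"
    define cs where "cs = comp_of_set N S"
    \<comment> \<open>With 0 and \<open>N\<close> added at the ends, the parts are the consecutive
      differences of \<open>zs\<close>, so their partial sums telescope to the entries of
      \<open>zs\<close>.\<close>
    define zs where "zs = 0 # xs @ [N]"
    have "finite S" using assms finite_subset by blast
    then have xs: "sorted_wrt (<) xs" "set xs = S"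
      by (simp_all add: xs_def)
    then have zs: "sorted_wrt (<) zs"
      using assms False by (auto simp: zs_def sorted_wrt_append)
    have cs: "cs = map2 (-) (xs @ [N]) (0 # xs)"
      using False by (simp add: cs_def comp_of_set_def xs_def Let_def)
    then have len: "length cs = Suc (length xs)" by simp
    have nth: "cs ! k = zs ! Suc k - zs ! k" if "k < length cs" for k
      using that by (cases k) (auto simp: cs zs_def nth_append)
    \<comment> \<open>Strict growth makes the parts positive and the truncated subtraction
      exact.\<close>
    have less: "zs ! k < zs ! Suc k" if "k < length cs" for k
      using that sorted_wrt_nth_less[OF zs, of k "Suc k"] by (simp add: zs_def len)
    have take: "sum_list (take k cs) = zs ! k" if "k \<le> length cs" for k
      using that
    proof (induction k)
      case 0
      then show ?case by (simp add: zs_def)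
    next
      case (Suc k)
      then show ?case using less[of k] nth[of k] by (simp add: take_Suc_conv_app_nth)
    qed
    have "sum_list cs = N"
      using take[of "length cs"] by (simp add: zs_def len)
    moreover have "\<forall>c\<in>set cs. 0 < c"
      using nth less by (auto simp: in_set_conv_nth)
    moreover have "set_of_comp cs = set xs"
    proof -
      \<comment> \<open>The range of \<open>k\<close> omits both added ends 0 and \<open>N\<close>,
        leaving the entries of \<open>xs\<close> with the index shifted by one.\<close>
      have "set_of_comp cs = {zs ! k |k. 1 \<le> k \<and> k < length cs}"
        unfolding set_of_comp_def by (intro Collect_cong ex_cong1) (use take in auto)
      also have "\<dots> = {xs ! k |k. k < length xs}"
      proof (intro equalityI subsetI; elim CollectE exE conjE)
        fix x k assume "x = zs ! k" "1 \<le> k" "k < length cs"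
        then show "x \<in> {xs ! k |k. k < length xs}"
          by (cases k) (auto simp: zs_def len nth_append)
      next
        fix x k assume "x = xs ! k" "k < length xs"
        then show "x \<in> {zs ! k |k. 1 \<le> k \<and> k < length cs}"
          by (auto simp: zs_def len nth_append intro!: exI[of _ "Suc k"])
      qed
      finally show ?thesis by (auto simp: set_conv_nth)
    qed
    ultimately show ?thesis using xs(2) by (simp add: composition_def flip: cs_def)
  qed
  then show "composition (comp_of_set N S) N" "set_of_comp (comp_of_set N S) = S" by blast+
qed

text \<open>List the basis by increasing \<open>\<mu>\<close>. A descent of a basis vector sends it
  into the span of strictly earlier ones, so the spans of the prefixes form a flag of submodules,
  and each new basis vector contributes the simple factor given by its set
  \<open>D b\<close>.\<close>

lemma (in hecke_rep) has_qsym_char_triangular: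
  fixes D :: "'b \<Rightarrow> nat set" and \<mu> :: "'b \<Rightarrow> 'o::linorder"
  assumes "finite B" and D: "\<And>b. b \<in> B \<Longrightarrow> D b \<subseteq> {1..<N}"
    and asc: "\<And>i b. i \<in> {1..<N} \<Longrightarrow> b \<in> B \<Longrightarrow> i \<notin> D b \<Longrightarrow> p i b = basis_vec b"
    and des: "\<And>i b. i \<in> D b \<Longrightarrow> b \<in> B \<Longrightarrow> p i b \<in> basis_span {c \<in> B. \<mu> c < \<mu> b}"
  shows "has_qsym_char N (hecke_module B p)
    (\<lambda>mon. \<Sum>b\<in>B. fundamental_qsym (comp_of_set N (D b)) mon)"
proof -
  obtain xs where "set xs = B" "distinct xs" using finite_distinct_list[OF \<open>finite B\<close>] by blast
  define bs where "bs = sort_key \<mu> xs"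
  have bs: "set bs = B" "distinct bs" "sorted (map \<mu> bs)"
    using \<open>set xs = B\<close> \<open>distinct xs\<close> by (simp_all add: bs_def)
  define A where "A j = set (take j bs)" for j
  have A_Suc: "A (Suc j) = insert (bs ! j) (A j)" if "j < length bs" for j
    using that by (auto simp: A_def take_Suc_conv_app_nth)
  have A_new: "bs ! j \<notin> A j" if "j < length bs" for j
    using that bs(2) by (auto simp: A_def in_set_conv_nth nth_eq_iff_index_eq)
  have A_B: "A j \<subseteq> B" for j
    using set_take_subset[of j bs] bs(1) by (simp add: A_def)
  have A_mono: "A i \<subseteq> A j" if "i \<le> j" for i j
    unfolding A_def using that by (rule set_take_subset_set_take)
  \<comment> \<open>Sortedness puts every element of strictly smaller weight earlier; the order
    among equal weights does not matter.\<close>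
  have below: "{c \<in> B. \<mu> c < \<mu> (bs ! j)} \<subseteq> A j" if "j < length bs" for j
  proof
    fix c assume c: "c \<in> {c \<in> B. \<mu> c < \<mu> (bs ! j)}"
    then obtain l where l: "l < length bs" "c = bs ! l" using bs(1) by (auto simp: in_set_conv_nth)
    have "l < j"
    proof (rule ccontr)
      assume "\<not> l < j"
      then have "\<mu> (bs ! j) \<le> \<mu> (bs ! l)"
        using sorted_nth_mono[OF bs(3), of j l] l by simp
      moreover have "\<mu> (bs ! l) < \<mu> (bs ! j)" using c l by simp
      ultimately show False by order
    qed
    with l show "c \<in> A j" by (auto simp: A_def in_set_conv_nth)
  qed
  have des': "p i (bs ! j) \<in> basis_span (A j)" if "j < length bs" "i \<in> D (bs ! j)" for i j
  proof -
    have "bs ! j \<in> B" using that(1) bs(1) nth_mem by blast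
    with des[OF that(2)] basis_span_mono[OF below[OF that(1)]] show ?thesis by blast
  qed
  have stable: "p i b \<in> basis_span (A j)" if i: "i \<in> {1..<N}" and b: "b \<in> A j" for i j b
  proof -
    obtain l where l: "l < j" "l < length bs" "b = bs ! l"
      using b by (auto simp: A_def in_set_conv_nth)
    show ?thesis
    proof (cases "i \<in> D b")
      case True
      then show ?thesis
        using des'[of l i] l basis_span_mono[OF A_mono[of l j]] by auto
    next
      case False
      moreover have "b \<in> B" using b A_B by blast
      ultimately show ?thesis using asc[OF i] b by simp
    qed
  qed
  have rep: "hecke_rep N (A j) p" for j
    using A_B stable by (rule hecke_rep_subset)
  \<comment> \<open>The indices run from 0 to \<open>length bs\<close> inclusive: one more subspace
    than there are factors.\<close>
  define Ws where "Ws = map (\<lambda>j. basis_span (A j)) [0..<Suc (length bs)]"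
  define \<Gamma> where "\<Gamma> = map (\<lambda>b. comp_of_set N (D b)) bs"
  have Ws_nth: "Ws ! j = basis_span (A j)" if "j \<le> length bs" for j
    using that by (simp add: Ws_def nth_map_upt del: upt_Suc)
  have "composition_series N (hecke_module B p) Ws \<Gamma>"
    unfolding composition_series_def
  proof (intro conjI allI ballI impI)
    show "length Ws = length \<Gamma> + 1" by (simp add: Ws_def \<Gamma>_def)
    have "hd Ws = basis_span (A 0)" by (simp add: Ws_def hd_map del: upt_Suc)
    moreover have "basis_span {} = {0 :: 'b \<Rightarrow>\<^sub>0 complex}" by (simp add: basis_span_def)
    ultimately show "hd Ws = {\<zero>\<^bsub>hecke_module B p\<^esub>}" by (simp add: A_def)
    show "last Ws = carrier (hecke_module B p)"
      by (simp add: Ws_def A_def bs(1))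
    show "submodule W (hecke0 N) (hecke_module B p)" if W: "W \<in> set Ws" for W
    proof -
      obtain j where "W = basis_span (A j)" using W unfolding Ws_def by auto
      then show ?thesis using submodule_hecke_module[OF rep A_B] by simp
    qed
    fix j assume "j < length \<Gamma>"
    then have j: "j < length bs" by (simp add: \<Gamma>_def)
    then have b: "bs ! j \<in> B" using bs(1) nth_mem by blast
    show "Ws ! j \<subseteq> Ws ! (j + 1)"
      using j by (simp add: Ws_nth basis_span_mono A_mono)
    show "composition (\<Gamma> ! j) N"
      using j b D by (simp add: \<Gamma>_def composition_comp_of_set)
    have setc: "set_of_comp (\<Gamma> ! j) = D (bs ! j)"
      using j set_of_comp_of_set[OF D[OF b]] by (simp add: \<Gamma>_def)
    have "module_isomorphic (hecke0 N)
        (quotient_module (hecke_module (insert (bs ! j) (A j)) p) (basis_span (A j)))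
        (simple_module (\<Gamma> ! j))"
    proof (rule hecke_quotient_simple)
      show "hecke_rep N (insert (bs ! j) (A j)) p" using rep[of "Suc j"] by (simp add: A_Suc j)
      show "bs ! j \<notin> A j" using j by (rule A_new)
      show "p i (bs ! j) \<in> basis_span (A j)" if "i \<in> set_of_comp (\<Gamma> ! j)" for i
        using that j by (simp add: setc des')
      show "p i (bs ! j) = basis_vec (bs ! j)" if "i \<in> {1..<N}" "i \<notin> set_of_comp (\<Gamma> ! j)" for i
        using that b asc by (simp add: setc)
    qed (rule stable)
    then show "module_isomorphic (hecke0 N)
        (quotient_module ((hecke_module B p)\<lparr>carrier := Ws ! (j + 1)\<rparr>) (Ws ! j)) (simple_module (\<Gamma> ! j))"
      using j by (simp add: Ws_nth A_Suc)
  qed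
  moreover have "(\<Sum>\<gamma>\<leftarrow>\<Gamma>. fundamental_qsym \<gamma> mon)
      = (\<Sum>b\<in>B. fundamental_qsym (comp_of_set N (D b)) mon)" for mon
    using bs sum_list_distinct_conv_sum_set[of bs] by (simp add: \<Gamma>_def comp_def)
  ultimately show ?thesis
    unfolding has_qsym_char_def using left_module_hecke_module by force
qed

section \<open>Tableaux\<close>

lemma finite_skew: "finite (skew \<alpha> \<beta>)"
proof -
  have "diagram \<alpha> = Sigma {..<length \<alpha>} (\<lambda>r. {..<\<alpha> ! r})" by (auto simp: diagram_def)
  then show ?thesis by (simp add: skew_def)
qed

lemma finite_SIT: "finite (SIT \<alpha> \<beta>)"
proof (rule finite_subset)
  show "finite {T. \<forall>x. (x \<in> skew \<alpha> \<beta> \<longrightarrow> T x \<in> {1..sum_list \<alpha> - sum_list \<beta>}) \<and>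
      (x \<notin> skew \<alpha> \<beta> \<longrightarrow> T x = 0)}"
    by (rule finite_set_of_finite_funs[OF finite_skew]) simp
  show "SIT \<alpha> \<beta> \<subseteq> {T. \<forall>x. (x \<in> skew \<alpha> \<beta> \<longrightarrow> T x \<in> {1..sum_list \<alpha> - sum_list \<beta>}) \<and>
      (x \<notin> skew \<alpha> \<beta> \<longrightarrow> T x = 0)}"
    by (auto simp: SIT_def dest!: bij_betwE)
qed

lemma SET_subset_SIT: "SET \<alpha> \<beta> \<subseteq> SIT \<alpha> \<beta>"
  by (auto simp: SET_def)

text \<open>Entries are nonzero, which excludes cells off the diagram, and injectivity excludes the
  other cells on it. So the description in \<open>row_of\<close> is proper.\<close>

lemma row_of_entry:
  assumes "T \<in> SIT \<alpha> \<beta>" "(r, c) \<in> skew \<alpha> \<beta>"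
  shows "row_of T (T (r, c)) = r"
proof -
  have zero: "T x = 0" if "x \<notin> skew \<alpha> \<beta>" for x
    using assms(1) that unfolding SIT_def by blast
  have bij: "bij_betw T (skew \<alpha> \<beta>) {1..sum_list \<alpha> - sum_list \<beta>}"
    using assms(1) unfolding SIT_def by blast
  have "T (r, c) \<noteq> 0" using bij_betwE[OF bij] assms(2) by fastforce
  have unique: "r' = r" if "T (r', c') = T (r, c)" for r' c'
  proof -
    have "(r', c') \<in> skew \<alpha> \<beta>"
      using zero[of "(r', c')"] \<open>T (r, c) \<noteq> 0\<close> that by auto
    then show ?thesis
      using inj_onD[OF bij_betw_imp_inj_on[OF bij] that _ assms(2)] by simp
  qed
  show ?thesis
    unfolding row_of_def by (rule the_equality) (use unique in blast)+
qed

lemma SIT_cell: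
  assumes "T \<in> SIT \<alpha> \<beta>" "i \<in> {1..sum_list \<alpha> - sum_list \<beta>}"
  obtains c where "(row_of T i, c) \<in> skew \<alpha> \<beta>" "T (row_of T i, c) = i"
proof -
  have "bij_betw T (skew \<alpha> \<beta>) {1..sum_list \<alpha> - sum_list \<beta>}"
    using assms(1) by (simp add: SIT_def)
  then obtain r c where "(r, c) \<in> skew \<alpha> \<beta>" "T (r, c) = i"
    using assms(2) unfolding bij_betw_def by (metis (no_types, lifting) imageE surj_pair)
  with row_of_entry[OF assms(1)] that show thesis by metis
qed

text \<open>A transposition is its own inverse, so both sides describe a row by the same predicate.
  The identity thus holds for arbitrary fillings, and so do the sorting relations derived from
  it.\<close>

lemma row_of_swap: "row_of (transpose i j \<circ> T) k = row_of T (transpose i j k)"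
  unfolding row_of_def comp_def by (metis transpose_involutory)

section \<open>Stability of tableaux under exchange of consecutive entries\<close>

lemma transpose_Suc_less:
  fixes a b i :: nat
  assumes "a < b" "\<not> (a = i \<and> b = i + 1)"
  shows "transpose i (i + 1) a < transpose i (i + 1) b"
  using assms by (auto simp: transpose_def)

lemma swap_in_SIT:
  assumes T: "T \<in> SIT \<alpha> \<beta>" and i: "i \<in> {1..<sum_list \<alpha> - sum_list \<beta>}"
    and below: "row_of T (i + 1) < row_of T i"
  shows "transpose i (i + 1) \<circ> T \<in> SIT \<alpha> \<beta>"
proof -
  \<comment> \<open>With \<open>r = r'\<close> this gives the row condition, with
    \<open>r < r'\<close> the condition on the first column.\<close>
  have less: "transpose i (i + 1) (T (r, c)) < transpose i (i + 1) (T (r', c'))"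
    if "(r, c) \<in> skew \<alpha> \<beta>" "(r', c') \<in> skew \<alpha> \<beta>" "T (r, c) < T (r', c')" "r \<le> r'" for r c r' c'
  proof (rule transpose_Suc_less[OF that(3)])
    show "\<not> (T (r, c) = i \<and> T (r', c') = i + 1)"
      using row_of_entry[OF T that(1)] row_of_entry[OF T that(2)] below that(4) by auto
  qed
  have "bij_betw (transpose i (i + 1)) {1..sum_list \<alpha> - sum_list \<beta>} {1..sum_list \<alpha> - sum_list \<beta>}"
    using i by (simp add: bij_betw_def)
  then have "bij_betw (transpose i (i + 1) \<circ> T) (skew \<alpha> \<beta>) {1..sum_list \<alpha> - sum_list \<beta>}"
    using T by (auto simp: SIT_def intro: bij_betw_trans)
  \<comment> \<open>As \<open>i\<close> is at least 1, the default value 0 off the diagram survives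
    the exchange.\<close>
  moreover have "transpose i (i + 1) 0 = 0" using i by (auto simp: transpose_def)
  ultimately show ?thesis
    using T less unfolding SIT_def by (simp del: Suc_eq_plus1 add_Suc_right)
qed

lemma swap_in_SET:
  assumes T: "T \<in> SET \<alpha> \<beta>" and i: "i \<in> {1..<sum_list \<alpha> - sum_list \<beta>}"
    and below: "row_of T (i + 1) < row_of T i"
  shows "transpose i (i + 1) \<circ> T \<in> SET \<alpha> \<beta>"
proof -
  have T': "T \<in> SIT \<alpha> \<beta>" using T SET_subset_SIT by blast
  have "transpose i (i + 1) (T (r, c)) < transpose i (i + 1) (T (r', c))"
    if "(r, c) \<in> skew \<alpha> \<beta>" "(r', c) \<in> skew \<alpha> \<beta>" "r < r'" for r r' c
  proof (rule transpose_Suc_less)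
    show "T (r, c) < T (r', c)" using T that by (auto simp: SET_def)
    show "\<not> (T (r, c) = i \<and> T (r', c) = i + 1)"
      using row_of_entry[OF T' that(1)] row_of_entry[OF T' that(2)] below that(3) by auto
  qed
  then show ?thesis using swap_in_SIT[OF T' i below] by (simp add: SET_def)
qed

text \<open>Rows increase, so \<open>i\<close> stands to the left of \<open>i + 1\<close>, and the
  exchange would reverse them. This is why the first action gives 0 on such a descent.\<close>

lemma swap_same_row_notin_SIT:
  assumes T: "T \<in> SIT \<alpha> \<beta>" and i: "i \<in> {1..<sum_list \<alpha> - sum_list \<beta>}"
    and same: "row_of T (i + 1) = row_of T i"
  shows "transpose i (i + 1) \<circ> T \<notin> SIT \<alpha> \<beta>"
proof
  assume S: "transpose i (i + 1) \<circ> T \<in> SIT \<alpha> \<beta>"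
  let ?r = "row_of T i"
  obtain c where c: "(?r, c) \<in> skew \<alpha> \<beta>" "T (?r, c) = i"
    using SIT_cell[OF T, of i] i by auto
  obtain d where d: "(?r, d) \<in> skew \<alpha> \<beta>" "T (?r, d) = i + 1"
    using SIT_cell[OF T, of "i + 1"] i same by auto
  have rows: "U (?r, a) < U (?r, b)"
    if "U \<in> SIT \<alpha> \<beta>" "(?r, a) \<in> skew \<alpha> \<beta>" "(?r, b) \<in> skew \<alpha> \<beta>" "a < b" for U a b
    using that by (simp add: SIT_def)
  show False
  proof (cases c d rule: linorder_cases)
    case less
    then show ?thesis using rows[OF S c(1) d(1)] c d by simp
  next
    case equal
    then show ?thesis using c d by simp
  next
    case greater
    then show ?thesis using rows[OF T d(1) c(1)] c d by simp
  qed
qed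

text \<open>The two actions differ only in the scalar \<open>z\<close> by which \<open>\<pi>\<^sub>i\<close> acts when \<open>i\<close> and
  \<open>i + 1\<close> share a row: \<open>0\<close> for the first, \<open>1\<close> for the second. In terms of the sequence of
  rows of \<open>1, 2, \<dots>\<close> it sorts the entries at \<open>i\<close> and \<open>i + 1\<close>, on arbitrary fillings.\<close>

definition sort_action :: "complex \<Rightarrow> nat \<Rightarrow> filling \<Rightarrow> filling \<Rightarrow>\<^sub>0 complex" where
  "sort_action z i T =
     (if row_of T i < row_of T (i + 1) then basis_vec T
      else if row_of T (i + 1) < row_of T i then basis_vec (transpose i (i + 1) \<circ> T)
      else cscale z (basis_vec T))"

section \<open>The 0-Hecke relations for sorting\<close>

lemma sort_action_idem:
  assumes "z * z = z"
  shows "linear_ext (sort_action z i) (sort_action z i T) = sort_action z i T"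
  using assms by (simp add: sort_action_def row_of_swap linear_ext_scale)

text \<open>The two transpositions move disjoint pairs, so neither alters the rows consulted by the
  other.\<close>

lemma sort_action_far:
  assumes "i + 2 \<le> j"
  shows "linear_ext (sort_action z i) (sort_action z j T) = linear_ext (sort_action z j) (sort_action z i T)"
proof -
  have tr: "transpose i (Suc i) j = j" "transpose i (Suc i) (Suc j) = Suc j"
    "transpose j (Suc j) i = i" "transpose j (Suc j) (Suc i) = Suc i"
    using assms by (simp_all add: transpose_def)
  have "transpose i (Suc i) \<circ> (transpose j (Suc j) \<circ> T) = transpose j (Suc j) \<circ> (transpose i (Suc i) \<circ> T)"
    using assms by (auto simp: fun_eq_iff transpose_def)
  then show ?thesis
    by (simp add: sort_action_def row_of_swap linear_ext_scale tr mult.commute)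
qed

text \<open>Both sides sort three letters. If two letters tie, the sides may collect different
  powers of \<open>z\<close>, which \<open>z * z = z\<close> makes equal.\<close>

lemma sort_action_braid:
  assumes "z * z = z"
  shows "linear_ext (sort_action z i) (linear_ext (sort_action z (i + 1)) (sort_action z i T)) =
    linear_ext (sort_action z (i + 1)) (linear_ext (sort_action z i) (sort_action z (i + 1) T))"
proof -
  let ?s = "transpose i (Suc i)" and ?t = "transpose (Suc i) (Suc (Suc i))"
  have tr: "?s (Suc (Suc i)) = Suc (Suc i)" "?t i = i"
    by (simp_all add: transpose_def)
  \<comment> \<open>Needed when the three rows strictly decrease and every step exchanges.\<close>
  have "?s \<circ> (?t \<circ> (?s \<circ> T)) = ?t \<circ> (?s \<circ> (?t \<circ> T))"
    by (auto simp: fun_eq_iff transpose_def)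
  then show ?thesis
    using assms
    by (cases "row_of T i" "row_of T (Suc i)" rule: linorder_cases;
        cases "row_of T (Suc i)" "row_of T (Suc (Suc i))" rule: linorder_cases;
        cases "row_of T i" "row_of T (Suc (Suc i))" rule: linorder_cases;
        simp add: sort_action_def row_of_swap linear_ext_scale tr)
qed

text \<open>The relations hold on all fillings, so a set of tableaux only has to be closed under
  exchanges at strict descents.\<close>

lemma hecke_rep_sort_action:
  assumes "z * z = z"
    and "\<And>i T. i \<in> {1..<N} \<Longrightarrow> T \<in> B \<Longrightarrow> row_of T (i + 1) < row_of T i \<Longrightarrow> transpose i (i + 1) \<circ> T \<in> B"
  shows "hecke_rep N B (sort_action z)"
proof
  show "sort_action z i T \<in> basis_span B" if "i \<in> {1..<N}" "T \<in> B" for i T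
    using that assms(2) by (simp add: sort_action_def basis_span_scale)
qed (rule sort_action_idem[OF assms(1)] sort_action_braid[OF assms(1)] sort_action_far; assumption)+

text \<open>Serves to replace sorting by the tableau action, with which it is compared on tableaux
  only. Stability keeps every intermediate vector in the span where the two operators agree.\<close>

lemma hecke_rep_cong:
  assumes "hecke_rep N B p" and eq: "\<And>i b. i \<in> {1..<N} \<Longrightarrow> b \<in> B \<Longrightarrow> q i b = p i b"
  shows "hecke_rep N B q"
proof -
  interpret hecke_rep N B p by fact
  have ext: "linear_ext (q i) v = linear_ext (p i) v" if "i \<in> {1..<N}" "v \<in> basis_span B" for i v
    using linear_eqI[OF linear_linear_ext linear_linear_ext _ that(2), of "q i" "p i"] eq that(1) by simp
  have ext_closed: "linear_ext (p i) v \<in> basis_span B" if "i \<in> {1..<N}" "v \<in> basis_span B" for i v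
    using that closed by (intro linear_ext_in_basis_span)
  show ?thesis
  proof
    fix i b assume i: "i \<in> {1..<N}" and b: "b \<in> B"
    show "q i b \<in> basis_span B" using closed eq i b by simp
    show "linear_ext (q i) (q i b) = q i b" using i b by (simp only: eq ext closed idem)
    show "linear_ext (q i) (linear_ext (q (i + 1)) (q i b)) =
        linear_ext (q (i + 1)) (linear_ext (q i) (q (i + 1) b))" if "i + 1 \<in> {1..<N}"
      using i b that by (simp only: eq ext ext_closed closed braid)
    show "linear_ext (q i) (q j b) = linear_ext (q j) (q i b)" if "j \<in> {1..<N}" "i + 2 \<le> j" for j
      using far[OF i that b] i b that by (simp only: eq ext closed)
  qed
qed

text \<open>Swapping a descent moves the larger entry into the higher row.\<close>

lemma row_weight_swap:
  assumes T: "T \<in> SIT \<alpha> \<beta>" and i: "i \<in> {1..<sum_list \<alpha> - sum_list \<beta>}"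
    and below: "row_of T (i + 1) < row_of T i"
  shows "(\<Sum>x\<in>skew \<alpha> \<beta>. fst x * T x) < (\<Sum>x\<in>skew \<alpha> \<beta>. fst x * (transpose i (i + 1) \<circ> T) x)"
proof -
  let ?s = "transpose i (i + 1)"
  obtain c where c: "(row_of T i, c) \<in> skew \<alpha> \<beta>" "T (row_of T i, c) = i"
    using SIT_cell[OF T, of i] i by auto
  obtain d where d: "(row_of T (i + 1), d) \<in> skew \<alpha> \<beta>" "T (row_of T (i + 1), d) = i + 1"
    using SIT_cell[OF T, of "i + 1"] i by auto
  define x y where "x = (row_of T i, c)" and "y = (row_of T (i + 1), d)"
  have xy: "x \<in> skew \<alpha> \<beta>" "y \<in> skew \<alpha> \<beta>" "T x = i" "T y = i + 1" "x \<noteq> y" "fst y < fst x"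
    using c d below by (auto simp: x_def y_def)
  have inj: "inj_on T (skew \<alpha> \<beta>)" using T by (auto simp: SIT_def bij_betw_def)
  let ?R = "skew \<alpha> \<beta> - {x} - {y}"
  \<comment> \<open>Only the cells \<open>x\<close> and \<open>y\<close> of the entries
    \<open>i\<close> and \<open>i + 1\<close> change, so their terms are split off.\<close>
  have split: "(\<Sum>u\<in>skew \<alpha> \<beta>. g u) = g x + (g y + (\<Sum>u\<in>?R. g u))" for g :: "nat \<times> nat \<Rightarrow> nat"
    using xy finite_skew by (simp add: sum.remove[of _ x] sum.remove[of _ y])
  have "(\<Sum>u\<in>?R. fst u * (?s \<circ> T) u) = (\<Sum>u\<in>?R. fst u * T u)"
  proof (rule sum.cong[OF refl])
    fix u assume u: "u \<in> ?R"
    then have "T u \<noteq> i" "T u \<noteq> i + 1" using inj_onD[OF inj, of u x] inj_onD[OF inj, of u y] xy by auto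
    then show "fst u * (?s \<circ> T) u = fst u * T u" by (simp add: transpose_def)
  qed
  \<comment> \<open>The gain is \<open>fst x - fst y\<close>, which is positive because
    \<open>y\<close> lies strictly below \<open>x\<close>.\<close>
  moreover have "fst x * i + fst y * (i + 1) < fst x * (i + 1) + fst y * i" using xy by simp
  ultimately show ?thesis
    unfolding split[of "\<lambda>u. fst u * T u"] split[of "\<lambda>u. fst u * (?s \<circ> T) u"]
    using xy by simp
qed

text \<open>Treats both actions at once: two consecutive entries in the same row form a descent
  exactly when \<open>z = 0\<close>.\<close>

lemma tableau_hecke_modules:
  fixes z :: complex and \<alpha> \<beta> :: "nat list" and Des :: "filling \<Rightarrow> nat set"
  defines "N \<equiv> sum_list \<alpha> - sum_list \<beta>" and "p \<equiv> tableau_action Des \<alpha> \<beta>"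
  assumes z: "z = 0 \<or> z = 1"
    and Des: "\<And>T. Des T = {i \<in> {1..<N}. row_of T (i + 1) < row_of T i \<or>
      z = 0 \<and> row_of T (i + 1) = row_of T i}"
  shows "left_module (hecke0 N) (hecke_module (SIT \<alpha> \<beta>) p)"
    and "submodule (basis_span (SET \<alpha> \<beta>)) (hecke0 N) (hecke_module (SIT \<alpha> \<beta>) p)"
    and "has_qsym_char N (hecke_module (SET \<alpha> \<beta>) p)
      (\<lambda>mon. \<Sum>T\<in>SET \<alpha> \<beta>. fundamental_qsym (comp_of_set N (Des T)) mon)"
proof -
  have zz: "z * z = z" using z by auto
  \<comment> \<open>At a strict descent the exchange stays in \<open>SIT\<close>. In a common row it
    leaves \<open>SIT\<close>, giving 0 if \<open>z = 0\<close>; if \<open>z = 1\<close> there is no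
    descent and \<open>T\<close> is fixed.\<close>
  have p: "p i T = sort_action z i T" if "i \<in> {1..<N}" "T \<in> SIT \<alpha> \<beta>" for i T
    using that swap_in_SIT[of T \<alpha> \<beta> i] swap_same_row_notin_SIT[of T \<alpha> \<beta> i] z
    by (cases "row_of T i" "row_of T (i + 1)" rule: linorder_cases)
      (auto simp: p_def N_def tableau_action_def sort_action_def Des[unfolded N_def])
  have SIT: "hecke_rep N (SIT \<alpha> \<beta>) p"
    by (rule hecke_rep_cong[OF hecke_rep_sort_action[OF zz]]) 
      (use swap_in_SIT p in \<open>auto simp: N_def\<close>)
  have SET: "hecke_rep N (SET \<alpha> \<beta>) p"
    by (rule hecke_rep_cong[OF hecke_rep_sort_action[OF zz]])
      (use swap_in_SET p[OF _ subsetD[OF SET_subset_SIT]] in \<open>auto simp: N_def\<close>)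
  show "left_module (hecke0 N) (hecke_module (SIT \<alpha> \<beta>) p)"
    using SIT by (rule hecke_rep.left_module_hecke_module)
  show "submodule (basis_span (SET \<alpha> \<beta>)) (hecke0 N) (hecke_module (SIT \<alpha> \<beta>) p)"
    using SET SET_subset_SIT by (rule submodule_hecke_module)
  \<comment> \<open>An exchange raises the row weight while the flag needs a decreasing one; hence
    the sign, and integers.\<close>
  define \<mu> :: "filling \<Rightarrow> int" where "\<mu> T = - int (\<Sum>x\<in>skew \<alpha> \<beta>. fst x * T x)" for T
  show "has_qsym_char N (hecke_module (SET \<alpha> \<beta>) p)
      (\<lambda>mon. \<Sum>T\<in>SET \<alpha> \<beta>. fundamental_qsym (comp_of_set N (Des T)) mon)"
  proof (rule hecke_rep.has_qsym_char_triangular[OF SET, where \<mu> = \<mu>])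
    show "finite (SET \<alpha> \<beta>)" using finite_subset[OF SET_subset_SIT finite_SIT] .
    fix i T assume T: "T \<in> SET \<alpha> \<beta>"
    then have T': "T \<in> SIT \<alpha> \<beta>" using SET_subset_SIT by blast
    show "p i T = basis_vec T" if "i \<in> {1..<N}" "i \<notin> Des T"
      using that by (simp add: p_def tableau_action_def)
    assume i: "i \<in> Des T"
    show "p i T \<in> basis_span {S \<in> SET \<alpha> \<beta>. \<mu> S < \<mu> T}"
    proof (cases "row_of T (i + 1) < row_of T i")
      case True
      have iN: "i \<in> {1..<N}" using i by (simp add: Des)
      then have "transpose i (i + 1) \<circ> T \<in> SET \<alpha> \<beta>" "\<mu> (transpose i (i + 1) \<circ> T) < \<mu> T"
        using swap_in_SET[OF T _ True] row_weight_swap[OF T' _ True]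
        unfolding N_def \<mu>_def by (blast, simp only: neg_less_iff_less of_nat_less_iff)
      then show ?thesis using True p[OF iN T'] by (simp add: sort_action_def)
    next
      \<comment> \<open>A descent that is not strict forces \<open>z = 0\<close> and a common row,
        so the image is 0, which lies in every span.\<close>
      case False
      then show ?thesis using i p[of i T] T' by (auto simp: Des sort_action_def)
    qed
  qed (auto simp: Des)
qed

theorem proposition4p9:
  fixes \<alpha> \<beta> :: "nat list" and n m :: nat
  assumes "composition \<alpha> n" and "composition \<beta> m" and "comp_contained \<beta> \<alpha>"
  shows "left_module (hecke0 (n - m)) (V_module \<alpha> \<beta>) \<and>
         submodule (basis_span (SET \<alpha> \<beta>)) (hecke0 (n - m)) (V_module \<alpha> \<beta>) \<and>
         has_qsym_char (n - m) ((V_module \<alpha> \<beta>)\<lparr>carrier := basis_span (SET \<alpha> \<beta>)\<rparr>) (RE \<alpha> \<beta>) \<and>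
         left_module (hecke0 (n - m)) (A_module \<alpha> \<beta>) \<and>
         submodule (basis_span (SET \<alpha> \<beta>)) (hecke0 (n - m)) (A_module \<alpha> \<beta>) \<and>
         has_qsym_char (n - m) ((A_module \<alpha> \<beta>)\<lparr>carrier := basis_span (SET \<alpha> \<beta>)\<rparr>) (A_SET \<alpha> \<beta>)"
proof -
  have N: "n - m = sum_list \<alpha> - sum_list \<beta>" using assms(1,2) by (simp add: composition_def)
  \<comment> \<open>The two descent sets are brought to the common form, with \<open>z = 0\<close>
    here and \<open>z = 1\<close> next.\<close>
  have RS: "Des_RS \<alpha> \<beta> T = {i \<in> {1..<sum_list \<alpha> - sum_list \<beta>}. row_of T (i + 1) < row_of T i \<or>
      (0::complex) = 0 \<and> row_of T (i + 1) = row_of T i}" for T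
    by (auto simp: Des_RS_def)
  have A: "Des_A \<alpha> \<beta> T = {i \<in> {1..<sum_list \<alpha> - sum_list \<beta>}. row_of T (i + 1) < row_of T i \<or>
      (1::complex) = 0 \<and> row_of T (i + 1) = row_of T i}" for T
    by (auto simp: Des_A_def)
  show ?thesis
    \<comment> \<open>By \<open>hecke_module_simps(5)\<close>, restricting the carrier to the span
      of \<open>SET\<close> gives the module built on \<open>SET\<close> with the same
      action.\<close>
    unfolding N V_module_def A_module_def RE_def A_SET_def hecke_module_simps(5)
    by (intro conjI tableau_hecke_modules[OF _ RS] tableau_hecke_modules[OF _ A]) simp_all
qed

end
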